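(* There exists an absolute constant $c>0$ such that for every positive integer $n$ there is a rhombus-free set $S\subseteq [n]^2$ with $|S|\ge c\,n^{4/3}$.
   Context: $[n]=\{1,\dots,n\}$ and $[n]^2=[n]\times[n]\subset\mathbb R^2$. $\|\cdot\|$ denotes the Euclidean norm. Four distinct points of $\mathbb R^2$ form a rhombus if they can be labelled $a,b,c,d$ so that $\|a-b\|=\|b-c\|=\|c-d\|=\|d-a\|$ (equivalently, they are the vertices of a parallelogram with all side lengths equal). A set is rhombus-free if it does not contain four distinct points forming a rhombus. *)

theory Defs
  imports "HOL-Analysis.Analysis"
begin

text \<open>
  The plane is \<^typ>\<open>real \<times> real\<close>, whose library norm is the Euclidean one (not the maximum norm).
\<close>

definition grid :: "nat \<Rightarrow> (real \<times> real) set" where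
  "grid n = (real ` {1..n}) \<times> (real ` {1..n})"

text \<open>The labelling is part of the data: \<open>a, b, c, d\<close> are listed in cyclic order.\<close>

definition rhombus :: "real \<times> real \<Rightarrow> real \<times> real \<Rightarrow> real \<times> real \<Rightarrow> real \<times> real \<Rightarrow> bool" where
  "rhombus a b c d \<longleftrightarrow>
     distinct [a, b, c, d] \<and>
     norm (a - b) = norm (b - c) \<and> norm (b - c) = norm (c - d) \<and> norm (c - d) = norm (d - a)"

definition rhombus_free :: "(real \<times> real) set \<Rightarrow> bool" where
  "rhombus_free S \<longleftrightarrow> \<not> (\<exists>a\<in>S. \<exists>b\<in>S. \<exists>c\<in>S. \<exists>d\<in>S. rhombus a b c d)"

end

(*
  Rhombi in [n]^2 number about n^4 log n, so plain random deletion loses a logarithmic factor.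
  It is recovered in three moves.

  (1) Keep each point of the grid independently with probability n^(-2/3 + 1/30) and delete a point
  from every pair of rhombi with at least two common points and from every triangle of rhombi. By
  first moments, what remains is a linear, triangle-free 4-uniform hypergraph with at least
  n^(4/3 + 1/30) / 2 vertices and edge density D = O(n^(1/10) log n).

  (2) Such a hypergraph on N vertices has an independent set of size c N (log D / D)^(1/3). Choose a
  random independent set I with probability proportional to exp (- U I), where the energy U I grows
  with the number of edges meeting I in 1, 2 or 3 vertices. If all independent sets are smaller than
  p N, Gibbs' inequality bounds the mean energy by N p (1 + log (1 / p)), so few edges are nearly full.
  On the other hand, by linearity and triangle-freeness the edges at a vertex v are conditionally
  independent given I outside the neighbourhood of v; hence v lies in I with probability at least
  exp (- C E), E being the expected increase of energy caused by v. Averaging over v gives a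
  contradiction unless p is of the stated order.

  (3) With N and D as in (1), the size in (2) is of order n^(4/3).
*)

theory Submission
  imports Defs "HOL-Real_Asymp.Real_Asymp"
begin

section \<open>Independent sets in linear triangle-free 4-uniform hypergraphs\<close>

lemma sum_Pow_Un_disjoint:
  fixes f :: "'a set \<Rightarrow> 'b::comm_monoid_add"
  assumes "A \<inter> B = {}"
  shows "(\<Sum>I\<in>Pow (A \<union> B). f I) = (\<Sum>J\<in>Pow A. \<Sum>C\<in>Pow B. f (J \<union> C))"
proof -
  have "(\<Sum>J\<in>Pow A. \<Sum>C\<in>Pow B. f (J \<union> C)) = (\<Sum>(J, C)\<in>Pow A \<times> Pow B. f (J \<union> C))"
    by (rule sum.cartesian_product)
  also have "\<dots> = (\<Sum>I\<in>Pow (A \<union> B). f I)"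
    by (rule sum.reindex_bij_witness[of _ "\<lambda>I. (I \<inter> A, I \<inter> B)" "\<lambda>(J, C). J \<union> C"])
      (use assms in auto)
  finally show ?thesis ..
qed

text \<open>Independence of disjoint blocks: a subset of the union is a free choice of one subset in
  each block, so a weight that factors over the blocks has a total that factors too.\<close>

lemma sum_Pow_UN_disjoint_prod:
  fixes g :: "'i \<Rightarrow> 'a set \<Rightarrow> 'b::comm_semiring_1"
  assumes "finite F" and "disjoint_family_on A F"
  shows "(\<Sum>C\<in>Pow (\<Union>e\<in>F. A e). \<Prod>e\<in>F. g e (C \<inter> A e)) = (\<Prod>e\<in>F. \<Sum>C\<in>Pow (A e). g e C)"
  using assms
proof (induction F rule: finite_induct)
  case empty
  then show ?case by simp
next
  case (insert x F)
  have disj: "A x \<inter> (\<Union>e\<in>F. A e) = {}"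
    using insert.prems insert.hyps by (fastforce simp: disjoint_family_on_def)
  have "(\<Sum>C\<in>Pow (\<Union>e\<in>insert x F. A e). \<Prod>e\<in>insert x F. g e (C \<inter> A e))
     = (\<Sum>J\<in>Pow (A x). \<Sum>C\<in>Pow (\<Union>e\<in>F. A e). \<Prod>e\<in>insert x F. g e ((J \<union> C) \<inter> A e))"
    using sum_Pow_Un_disjoint[OF disj] by simp
  also have "\<dots> = (\<Sum>J\<in>Pow (A x). \<Sum>C\<in>Pow (\<Union>e\<in>F. A e). g x J * (\<Prod>e\<in>F. g e (C \<inter> A e)))"
  proof (intro sum.cong refl)
    fix J C assume J: "J \<in> Pow (A x)" and C: "C \<in> Pow (\<Union>e\<in>F. A e)"
    have "(J \<union> C) \<inter> A x = J" using J C disj by blast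
    moreover have "(J \<union> C) \<inter> A e = C \<inter> A e" if "e \<in> F" for e
      using J that disj by blast
    ultimately show "(\<Prod>e\<in>insert x F. g e ((J \<union> C) \<inter> A e)) = g x J * (\<Prod>e\<in>F. g e (C \<inter> A e))"
      using insert.hyps by simp
  qed
  also have "\<dots> = (\<Sum>J\<in>Pow (A x). g x J) * (\<Sum>C\<in>Pow (\<Union>e\<in>F. A e). \<Prod>e\<in>F. g e (C \<inter> A e))"
    by (simp add: sum_product)
  also have "(\<Sum>C\<in>Pow (\<Union>e\<in>F. A e). \<Prod>e\<in>F. g e (C \<inter> A e)) = (\<Prod>e\<in>F. \<Sum>C\<in>Pow (A e). g e C)"
    using insert by (auto simp: disjoint_family_on_def)
  finally show ?case
    using insert.hyps by simp
qed

lemma sum_power_card_Pow: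
  fixes x :: "'b::comm_semiring_1"
  assumes "finite A"
  shows "(\<Sum>I\<in>Pow A. x ^ card I) = (1 + x) ^ card A"
  using prod_add[OF assms, of "\<lambda>_. x" "\<lambda>_. 1"] by (simp add: add.commute)

section \<open>Energy of an edge and the estimate for one edge at a vertex\<close>

text \<open>A convex function lies above its tangent at \<open>s\<close>. Averaged with
  \<open>s\<close> the mean of \<open>x\<close>, this is Jensen's inequality; with \<open>s\<close>
  left free it gives bounds that are linear in the averages and can be added up.\<close>

lemma exp_minus_tangent:
  fixes s x :: real
  shows "exp (-s) * (1 + s - x) \<le> exp (-x)"
proof -
  have "exp (-s) * (1 + (s - x)) \<le> exp (-s) * exp (s - x)"
    by (intro mult_left_mono exp_ge_add_one_self) auto
  then show ?thesis by (simp add: algebra_simps flip: exp_add)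
qed

lemma exp_minus_double_le:
  fixes x :: real
  assumes "0 \<le> x" "x \<le> 1/2"
  shows "exp (- 2 * x) \<le> 1 - x"
proof -
  have "exp (-2 * x) * (1 + 2 * x) \<le> exp (- 2 * x) * exp (2 * x)"
    by (intro mult_left_mono exp_ge_add_one_self) auto
  then have "exp (-2 * x) * (1 + 2 * x) \<le> 1" by (simp flip: exp_add)
  moreover have "1 \<le> (1 - x) * (1 + 2 * x)"
    using mult_nonneg_nonneg[of x "1 - 2 * x"] assms by (simp add: algebra_simps)
  ultimately have "exp (-2 * x) * (1 + 2 * x) \<le> (1 - x) * (1 + 2 * x)" by linarith
  then show ?thesis using assms by (simp add: mult_le_cancel_right)
qed

text \<open>
  The increments \<open>t ^ 3, t ^ 2, t, 1\<close> of the energy form a geometric progression, so that every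
  increment but the first is at most the accumulated energy divided by \<open>t\<close>. The last increment
  stands for the infinite cost of a full edge.
\<close>

definition energy :: "real \<Rightarrow> nat \<Rightarrow> real" where
  "energy t j = (\<Sum>i<j. t ^ (3 - i))"

definition penalty :: "real \<Rightarrow> nat \<Rightarrow> real" where
  "penalty t j = (if j \<le> 3 then exp (- energy t j) else 0)"

lemma energy_0 [simp]: "energy t 0 = 0"
  by (simp add: energy_def)

lemma energy_Suc: "energy t (Suc j) = energy t j + t ^ (3 - j)"
  by (simp add: energy_def)

lemma penalty_0 [simp]: "penalty t 0 = 1"
  by (simp add: penalty_def)

lemma penalty_nonneg [simp]: "0 \<le> penalty t j"
  by (simp add: penalty_def)

lemma penalty_Suc: "j < 3 \<Longrightarrow> penalty t (Suc j) = penalty t j * exp (- (t ^ (3 - j)))"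
  by (simp add: penalty_def energy_Suc exp_diff exp_minus field_simps)

lemma penalty_antimono:
  assumes "0 \<le> t" "i \<le> j"
  shows "penalty t j \<le> penalty t i"
proof -
  have "energy t i \<le> energy t j"
    unfolding energy_def using assms by (intro sum_mono2) auto
  then show ?thesis using assms by (auto simp: penalty_def)
qed

text \<open>For \<open>j > 0\<close>, \<open>t\<close> times the left side is the last summand of
  \<open>energy t j\<close>; for \<open>j = 0\<close> the left side is \<open>t ^ 3\<close>. In this
  way the mean energy controls the expected cost of one more vertex.\<close>

lemma power_le_energy:
  assumes t: "0 < t" and j: "j \<le> 3"
  shows "t ^ (3 - j) \<le> t ^ 3 + energy t j / t"
proof (cases j)
  case 0
  then show ?thesis by simp
next
  case (Suc i)
  have "3 - i = Suc (3 - j)" using Suc j by simp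
  then have "t * t ^ (3 - j) = t ^ (3 - i)" by simp
  also have "\<dots> \<le> energy t j"
    using t by (auto simp: Suc energy_Suc energy_def intro!: sum_nonneg)
  finally have "t ^ (3 - j) \<le> energy t j / t"
    using t by (simp add: field_simps)
  then show ?thesis using t by (simp add: add_increasing)
qed

text \<open>In the application \<open>X\<close> is an edge at a vertex \<open>v\<close> without
  \<open>v\<close>, and \<open>h\<close> is the weight of the edges off \<open>v\<close> that meet
  it. Then \<open>\<alpha>\<close> and \<open>\<beta>\<close> are the totals without and with
  \<open>v\<close>, and \<open>\<gamma> / \<alpha>\<close> is the mean increment of energy. Jensen's
  inequality handles all triples but the full one, which \<open>v\<close> would complete to an edge;
  dropping that one costs the factor 2 in the exponent.\<close>

lemma triple_estimate:
  fixes h :: "'a set \<Rightarrow> real"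
  assumes X: "card X = 3" and t: "0 \<le> t"
    and h0: "\<And>C. C \<subseteq> X \<Longrightarrow> 0 \<le> h C"
    and hmono: "h X \<le> h {}"
  defines "\<alpha> \<equiv> \<Sum>C\<in>Pow X. h C * penalty t (card C)"
    and "\<beta> \<equiv> \<Sum>C\<in>Pow X. h C * penalty t (Suc (card C))"
    and "\<gamma> \<equiv> \<Sum>C\<in>Pow X. h C * penalty t (card C) * t ^ (3 - card C)"
  assumes pos: "0 < \<alpha>"
  shows "\<alpha> * exp (- 2 * (\<gamma> / \<alpha>)) \<le> \<beta>"
proof -
  have fin: "finite X" using X by (metis card.infinite zero_neq_numeral)
  define q where "q = h X * penalty t 3"
  define P where "P = Pow X - {X}"
  have finP: "finite P" and PowX: "Pow X = insert X P" "X \<notin> P" using fin by (auto simp: P_def)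
  have q0: "0 \<le> q" using h0 by (simp add: q_def)
  have \<alpha>: "\<alpha> = q + (\<Sum>C\<in>P. h C * penalty t (card C))"
    using finP PowX X by (simp add: \<alpha>_def q_def)
  have \<gamma>: "\<gamma> = q + (\<Sum>C\<in>P. h C * penalty t (card C) * t ^ (3 - card C))"
    using finP PowX X by (simp add: \<gamma>_def q_def)
  have \<beta>: "\<beta> = (\<Sum>C\<in>P. h C * penalty t (Suc (card C)))"
    using finP PowX X by (simp add: \<beta>_def penalty_def)
  have small: "card C < 3" if "C \<in> P" for C
    using that fin X psubset_card_mono[of X C] by (auto simp: P_def)
  \<comment> \<open>The empty triple weighs at least as much as the full one and stays in
    \<open>P\<close>, so \<open>q\<close> is at most half of \<open>\<alpha>\<close>.\<close>
  have "q \<le> h {} * penalty t (card ({} :: 'a set))"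
    unfolding q_def using hmono h0 t by (intro mult_mono penalty_antimono) auto
  also have "\<dots> \<le> (\<Sum>C\<in>P. h C * penalty t (card C))"
    using finP X h0 by (intro member_le_sum[where f = "\<lambda>C. h C * penalty t (card C)"]) (auto simp: P_def)
  finally have half: "q \<le> \<alpha> / 2" using \<alpha> by simp
  define r where "r = \<alpha> - q"
  have r: "r = (\<Sum>C\<in>P. h C * penalty t (card C))" "\<alpha> / 2 \<le> r" "0 < r"
    using \<alpha> half pos by (auto simp: r_def)
  \<comment> \<open>Mean increment over \<open>P\<close>. In \<open>\<gamma>\<close> the full triple
    contributes exactly \<open>q\<close>, because its increment is \<open>t ^ 0\<close>.\<close>
  define s where "s = (\<gamma> - q) / r"
  have "\<gamma> - q \<ge> 0" unfolding \<gamma> using h0 t by (auto simp: P_def intro!: sum_nonneg mult_nonneg_nonneg)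
  then have sle: "s \<le> 2 * (\<gamma> - q) / \<alpha>"
    unfolding s_def using r(2,3) pos mult_left_mono[of \<alpha> "2 * r" "\<gamma> - q"]
    by (simp add: divide_simps mult_ac)
  \<comment> \<open>The tangent inequality at the mean \<open>s\<close>, summed over
    \<open>P\<close>; the linear terms cancel and \<open>exp (-s) * r\<close> is left.\<close>
  have "exp (-s) * (r * (1 + s) - (\<gamma> - q)) =
      (\<Sum>C\<in>P. h C * penalty t (card C) * (exp (-s) * (1 + s - t ^ (3 - card C))))"
    unfolding \<gamma> r(1)
    by (simp add: sum_distrib_left sum_distrib_right sum_subtractf algebra_simps sum.distrib)
  also have "\<dots> \<le> (\<Sum>C\<in>P. h C * penalty t (card C) * exp (- (t ^ (3 - card C))))"
    using h0 by (intro sum_mono mult_left_mono exp_minus_tangent) (auto simp: P_def)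
  also have "\<dots> = \<beta>"
    unfolding \<beta> using small by (intro sum.cong) (auto simp: penalty_Suc)
  finally have "exp (-s) * r \<le> \<beta>"
    using r by (simp add: s_def field_simps)
  \<comment> \<open>The loss of the full triple, from \<open>\<alpha>\<close> to \<open>r\<close>,
    is absorbed by an exponential because \<open>q / \<alpha>\<close> is at most 1/2.\<close>
  moreover have "\<alpha> * exp (- 2 * (q / \<alpha>)) \<le> \<alpha> * (1 - q / \<alpha>)"
    using q0 half pos by (intro mult_left_mono exp_minus_double_le) (auto simp: field_simps)
  then have "\<alpha> * exp (- 2 * (q / \<alpha>)) \<le> r"
    using pos by (simp add: right_diff_distrib r_def)
  then have "exp (-s) * (\<alpha> * exp (- 2 * (q / \<alpha>))) \<le> exp (-s) * r"
    by (intro mult_left_mono) auto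
  moreover have "exp (- 2 * (\<gamma> / \<alpha>)) \<le> exp (-s) * exp (- 2 * (q / \<alpha>))"
    using sle by (simp flip: exp_add add: diff_divide_distrib algebra_simps)
  then have "\<alpha> * exp (- 2 * (\<gamma> / \<alpha>)) \<le> \<alpha> * (exp (-s) * exp (- 2 * (q / \<alpha>)))"
    using pos by (intro mult_left_mono) auto
  ultimately show ?thesis
    using mult.left_commute[of \<alpha> "exp (-s)" "exp (- 2 * (q / \<alpha>))"] by linarith
qed

section \<open>The Gibbs measure on a linear triangle-free hypergraph\<close>

locale sparse_hypergraph =
  fixes V :: "'a set" and E :: "'a set set"
  assumes finite_V: "finite V"
    and edge_subset: "e \<in> E \<Longrightarrow> e \<subseteq> V"
    and edge_card: "e \<in> E \<Longrightarrow> card e = 4"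
    and linear: "\<lbrakk>e \<in> E; f \<in> E; e \<noteq> f\<rbrakk> \<Longrightarrow> card (e \<inter> f) \<le> 1"
    and triangle_free: "\<lbrakk>e \<in> E; e' \<in> E; f \<in> E; e \<noteq> e'; v \<in> e; v \<in> e'; v \<notin> f\<rbrakk>
      \<Longrightarrow> f \<inter> e = {} \<or> f \<inter> e' = {}"
begin

text \<open>Unnormalised Gibbs weight, with one Boltzmann factor for each edge. It vanishes as soon
  as \<open>I\<close> contains an edge, so the measure lives on independent sets.\<close>

definition weight :: "real \<Rightarrow> 'a set \<Rightarrow> real" where
  "weight t I = (\<Prod>e\<in>E. penalty t (card (e \<inter> I)))"

lemma finite_E: "finite E"
  by (rule finite_subset[of _ "Pow V"]) (use finite_V edge_subset in auto)

lemma finite_edge: "e \<in> E \<Longrightarrow> finite e"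
  using finite_subset[OF edge_subset finite_V] .

lemma weight_nonneg [simp]: "0 \<le> weight t I"
  by (simp add: weight_def prod_nonneg)

lemma weight_empty [simp]: "weight t {} = 1"
  by (simp add: weight_def)

lemma weight_antimono:
  assumes "0 \<le> t" "I \<subseteq> J"
  shows "weight t J \<le> weight t I"
  unfolding weight_def using assms finite_edge
  by (intro prod_mono conjI penalty_antimono card_mono) auto

text \<open>Two edges at \<open>v\<close> already share \<open>v\<close>, so linearity leaves them
  no second common point.\<close>

lemma edges_at_disjoint:
  "disjoint_family_on (\<lambda>e. e - {v}) {e \<in> E. v \<in> e}"
proof -
  have "(e - {v}) \<inter> (f - {v}) = {}" if "e \<in> E" "f \<in> E" "v \<in> e" "v \<in> f" "e \<noteq> f" for e f
  proof (rule ccontr)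
    assume "(e - {v}) \<inter> (f - {v}) \<noteq> {}"
    then obtain z where "z \<noteq> v" "z \<in> e" "z \<in> f" by blast
    then have "{v, z} \<subseteq> e \<inter> f" using that by simp
    moreover have "card (e \<inter> f) \<le> 1" "finite (e \<inter> f)" 
      using linear[of e f] finite_edge[of e] that by simp_all
    ultimately have "card {v, z} \<le> 1" using card_mono[of "e \<inter> f" "{v, z}"] by linarith
    with \<open>z \<noteq> v\<close> show False by simp
  qed
  then show ?thesis by (simp add: disjoint_family_on_def)
qed

text \<open>There are three kinds of edges: those at \<open>v\<close>, those off \<open>v\<close>
  that meet an edge at \<open>v\<close>, and those disjoint from all edges at \<open>v\<close>.
  Triangle-freeness assigns each edge of the second kind to just one edge at
  \<open>v\<close>.\<close>

lemma weight_split: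
  fixes v :: 'a
  defines "Ev \<equiv> {e \<in> E. v \<in> e}"
  shows "weight t B =
      (\<Prod>f | f \<in> E \<and> (\<forall>e\<in>Ev. f \<inter> e = {}). penalty t (card (f \<inter> B))) *
      (\<Prod>e\<in>Ev. (\<Prod>f | f \<in> E \<and> v \<notin> f \<and> f \<inter> e \<noteq> {}. penalty t (card (f \<inter> B))) *
         penalty t (card (e \<inter> B)))"
proof -
  define R where "R e = {f \<in> E. v \<notin> f \<and> f \<inter> e \<noteq> {}}" for e
  define R0 where "R0 = {f \<in> E. \<forall>e\<in>Ev. f \<inter> e = {}}"
  define g where "g f = penalty t (card (f \<inter> B))" for f
  have fin: "finite R0" "finite Ev" "\<And>e. finite (R e)"
    using finite_E by (auto simp: R0_def Ev_def R_def)
  have E: "E = (R0 \<union> (\<Union>e\<in>Ev. R e)) \<union> Ev"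
    by (auto simp: R0_def R_def Ev_def)
  have nonempty: "e \<noteq> {}" if "e \<in> E" for e
    using edge_card[OF that] by auto
  have disj: "R e \<inter> R e' = {}" if "e \<in> Ev" "e' \<in> Ev" "e \<noteq> e'" for e e'
    using that triangle_free[of e e' _ v] unfolding R_def Ev_def by blast
  have "(\<Prod>f\<in>E. g f) = (\<Prod>f\<in>R0 \<union> (\<Union>e\<in>Ev. R e). g f) * (\<Prod>f\<in>Ev. g f)"
    by (subst E, rule prod.union_disjoint) (use fin in \<open>auto simp: R0_def R_def Ev_def\<close>)
  also have "(\<Prod>f\<in>R0 \<union> (\<Union>e\<in>Ev. R e). g f) = (\<Prod>f\<in>R0. g f) * (\<Prod>f\<in>(\<Union>e\<in>Ev. R e). g f)"
    by (rule prod.union_disjoint) (use fin in \<open>auto simp: R0_def R_def Ev_def\<close>)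
  also have "(\<Prod>f\<in>(\<Union>e\<in>Ev. R e). g f) = (\<Prod>e\<in>Ev. \<Prod>f\<in>R e. g f)"
    using fin disj by (intro prod.UNION_disjoint) auto
  finally show ?thesis
    by (simp add: weight_def prod.distrib mult.assoc R0_def R_def g_def)
qed

text \<open>
  Conditionally on the part \<open>J\<close> of the random set outside the neighbourhood of \<open>v\<close>, the triples
  left by the edges at \<open>v\<close> are independent, because \<open>E\<close> is linear and triangle-free.
\<close>

lemma vertex_estimate_conditional:
  fixes v :: 'a
  assumes t: "0 \<le> t"
  defines "Ev \<equiv> {e \<in> E. v \<in> e}"
  defines "U \<equiv> \<Union>e\<in>Ev. e - {v}"
  assumes J: "J \<subseteq> V - {v} - U"
  shows "exp (-s) * ((1 + s) * (\<Sum>C\<in>Pow U. weight t (J \<union> C))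
      - 2 * (\<Sum>C\<in>Pow U. weight t (J \<union> C) * (\<Sum>e\<in>Ev. t ^ (3 - card (e \<inter> (J \<union> C))))))
    \<le> (\<Sum>C\<in>Pow U. weight t (insert v (J \<union> C)))"
proof -
  \<comment> \<open>\<open>h e C\<close> is the weight of the edges off \<open>v\<close> that meet
    \<open>e\<close>, and \<open>w0\<close> that of the edges away from all edges at
    \<open>v\<close>. The sums \<open>\<alpha> e\<close>, \<open>\<beta> e\<close>,
    \<open>\<gamma> e\<close> are those of \<open>triple_estimate\<close> for
    \<open>e - {v}\<close>.\<close>
  define h where "h e C = (\<Prod>f | f \<in> E \<and> v \<notin> f \<and> f \<inter> e \<noteq> {}. penalty t (card (f \<inter> (J \<union> C))))" for e C
  define w0 where "w0 = (\<Prod>f | f \<in> E \<and> (\<forall>e\<in>Ev. f \<inter> e = {}). penalty t (card (f \<inter> J)))"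
  define \<alpha> where "\<alpha> e = (\<Sum>C\<in>Pow (e - {v}). h e C * penalty t (card C))" for e
  define \<beta> where "\<beta> e = (\<Sum>C\<in>Pow (e - {v}). h e C * penalty t (Suc (card C)))" for e
  define \<gamma> where "\<gamma> e = (\<Sum>C\<in>Pow (e - {v}). h e C * penalty t (card C) * t ^ (3 - card C))" for e
  have finEv: "finite Ev" using finite_E by (simp add: Ev_def)
  have disj: "disjoint_family_on (\<lambda>e. e - {v}) Ev"
    unfolding Ev_def by (rule edges_at_disjoint)
  have w0: "0 \<le> w0" by (simp add: w0_def prod_nonneg)
  have h0: "0 \<le> h e C" for e C by (simp add: h_def prod_nonneg)
  have hmono: "h e C \<le> h e {}" for e C
    unfolding h_def using t finite_edge by (intro prod_mono conjI penalty_antimono card_mono) auto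
  have eJ: "e \<inter> J = {}" if "e \<in> Ev" for e
    using J that by (auto simp: U_def Ev_def)
  have far: "f \<inter> (J \<union> C) = f \<inter> J" if "\<forall>e\<in>Ev. f \<inter> e = {}" "C \<subseteq> U" for f C
    using that by (auto simp: U_def)
  \<comment> \<open>By triangle-freeness an edge off \<open>v\<close> that meets \<open>e\<close>
    meets \<open>U\<close> only inside \<open>e - {v}\<close>, so its factor does not see the other
    triples.\<close>
  have near: "f \<inter> (J \<union> C) = f \<inter> (J \<union> C \<inter> (e - {v}))"
    if "e \<in> Ev" "f \<in> E" "v \<notin> f" "f \<inter> e \<noteq> {}" "C \<subseteq> U" for f e C
  proof -
    have "f \<inter> C \<subseteq> e - {v}"
    proof
      fix z assume z: "z \<in> f \<inter> C"
      then have "z \<in> U" using \<open>C \<subseteq> U\<close> by blast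
      then obtain e' where e': "e' \<in> Ev" "z \<in> e' - {v}" by (auto simp: U_def)
      have "f \<inter> e' \<noteq> {}" using z e' by blast
      then have "e' = e"
        using triangle_free[of e e' f v] that e' by (auto simp only: Ev_def mem_Collect_eq)
      with e' show "z \<in> e - {v}" by simp
    qed
    then show ?thesis by blast
  qed
  have near_prod: "(\<Prod>f | f \<in> E \<and> v \<notin> f \<and> f \<inter> e \<noteq> {}. penalty t (card (f \<inter> (J \<union> C)))) =
      h e (C \<inter> (e - {v}))" if "e \<in> Ev" "C \<subseteq> U" for e C
    unfolding h_def
  proof (rule prod.cong[OF refl])
    fix f assume "f \<in> {f \<in> E. v \<notin> f \<and> f \<inter> e \<noteq> {}}"
    then have "f \<inter> (J \<union> C) = f \<inter> (J \<union> C \<inter> (e - {v}))"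
      using that by (intro near) simp_all
    then show "penalty t (card (f \<inter> (J \<union> C))) = penalty t (card (f \<inter> (J \<union> C \<inter> (e - {v}))))"
      by (rule arg_cong)
  qed
  have wgt: "weight t (J \<union> C) =
      w0 * (\<Prod>e\<in>Ev. h e (C \<inter> (e - {v})) * penalty t (card (C \<inter> (e - {v}))))"
    if C: "C \<subseteq> U" for C
  proof -
    have "e \<inter> (J \<union> C) = C \<inter> (e - {v})" if "e \<in> Ev" for e
      using C eJ[OF that] by (auto simp: U_def)
    then show ?thesis
      unfolding weight_split[of t _ v] w0_def Ev_def[symmetric]
      using far[OF _ C] near_prod[OF _ C] by simp
  qed
  have wgt': "weight t (insert v (J \<union> C)) =
      w0 * (\<Prod>e\<in>Ev. h e (C \<inter> (e - {v})) * penalty t (Suc (card (C \<inter> (e - {v})))))"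
    if C: "C \<subseteq> U" for C
  proof -
    have near': "card (e \<inter> insert v (J \<union> C)) = Suc (card (C \<inter> (e - {v})))" if "e \<in> Ev" for e
    proof -
      have "e \<inter> insert v (J \<union> C) = insert v (C \<inter> (e - {v}))"
        using C eJ[OF that] that by (auto simp: U_def Ev_def)
      moreover have "finite (C \<inter> (e - {v}))" using finite_edge that by (simp add: Ev_def)
      ultimately show ?thesis by simp
    qed
    have off_v: "f \<inter> insert v (J \<union> C) = f \<inter> (J \<union> C)" if "v \<notin> f" for f using that by simp
    have far': "f \<inter> insert v (J \<union> C) = f \<inter> J" if "f \<in> E" "\<forall>e\<in>Ev. f \<inter> e = {}" for f
    proof -
      have "f \<noteq> {}" using edge_card[OF that(1)] by auto
      then have "v \<notin> f" using that by (auto simp: Ev_def)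
      then show ?thesis using off_v far[OF that(2) C] by simp
    qed
    have "(\<Prod>f | f \<in> E \<and> (\<forall>e\<in>Ev. f \<inter> e = {}). penalty t (card (f \<inter> insert v (J \<union> C)))) = w0"
      unfolding w0_def by (rule prod.cong) (simp_all add: far')
    moreover have "(\<Prod>f | f \<in> E \<and> v \<notin> f \<and> f \<inter> e \<noteq> {}. penalty t (card (f \<inter> insert v (J \<union> C)))) =
        h e (C \<inter> (e - {v}))" if "e \<in> Ev" for e
      unfolding near_prod[OF that C, symmetric] by (rule prod.cong) (simp_all add: off_v)
    ultimately show ?thesis
      unfolding weight_split[of t _ v] Ev_def[symmetric] using near' by simp
  qed
  \<comment> \<open>Given \<open>J\<close>, the total weight factors over the triples. Adding
    \<open>v\<close> raises the count of every edge in \<open>Ev\<close> by one and turns each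
    \<open>\<alpha> e\<close> into \<open>\<beta> e\<close>.\<close>
  have A: "(\<Sum>C\<in>Pow U. weight t (J \<union> C)) = w0 * prod \<alpha> Ev"
  proof -
    have "(\<Sum>C\<in>Pow U. weight t (J \<union> C)) =
        w0 * (\<Sum>C\<in>Pow U. \<Prod>e\<in>Ev. h e (C \<inter> (e - {v})) * penalty t (card (C \<inter> (e - {v}))))"
      by (simp add: wgt sum_distrib_left)
    then show ?thesis
      unfolding U_def \<alpha>_def
      using sum_Pow_UN_disjoint_prod[OF finEv disj, of "\<lambda>e C. h e C * penalty t (card C)"] by simp
  qed
  have B: "(\<Sum>C\<in>Pow U. weight t (insert v (J \<union> C))) = w0 * prod \<beta> Ev"
  proof -
    have "(\<Sum>C\<in>Pow U. weight t (insert v (J \<union> C))) =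
        w0 * (\<Sum>C\<in>Pow U. \<Prod>e\<in>Ev. h e (C \<inter> (e - {v})) * penalty t (Suc (card (C \<inter> (e - {v})))))"
      by (simp add: wgt' sum_distrib_left)
    then show ?thesis
      unfolding U_def \<beta>_def
      using sum_Pow_UN_disjoint_prod[OF finEv disj, of "\<lambda>e C. h e C * penalty t (Suc (card C))"] by simp
  qed
  have G: "(\<Sum>C\<in>Pow U. weight t (J \<union> C) * (\<Sum>e\<in>Ev. t ^ (3 - card (e \<inter> (J \<union> C))))) =
      w0 * (\<Sum>e\<in>Ev. \<gamma> e * prod \<alpha> (Ev - {e}))"
  proof -
    have "(\<Sum>C\<in>Pow U. weight t (J \<union> C) * t ^ (3 - card (e \<inter> (J \<union> C)))) =
        w0 * (\<gamma> e * prod \<alpha> (Ev - {e}))" if e: "e \<in> Ev" for e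
    proof -
      \<comment> \<open>Inserting the increment of the single edge \<open>e\<close> changes only the
        factor of \<open>e\<close>, from \<open>\<alpha> e\<close> to
        \<open>\<gamma> e\<close>.\<close>
      define g where "g = (\<lambda>e' C. h e' C * penalty t (card C) * (if e' = e then t ^ (3 - card C) else 1))"
      have "weight t (J \<union> C) * t ^ (3 - card (e \<inter> (J \<union> C))) =
          w0 * (\<Prod>e'\<in>Ev. g e' (C \<inter> (e' - {v})))" if "C \<in> Pow U" for C
      proof -
        have C: "C \<subseteq> U" using that by simp
        have "e \<inter> (J \<union> C) = C \<inter> (e - {v})"
          using C eJ[OF e] by (auto simp: U_def)
        then show ?thesis
          using finEv e by (simp add: wgt[OF C] g_def prod.distrib[of _ _ Ev] prod.delta)
      qed
      then have "(\<Sum>C\<in>Pow U. weight t (J \<union> C) * t ^ (3 - card (e \<inter> (J \<union> C)))) =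
          w0 * (\<Sum>C\<in>Pow U. \<Prod>e'\<in>Ev. g e' (C \<inter> (e' - {v})))"
        by (simp add: sum_distrib_left)
      also have "(\<Sum>C\<in>Pow U. \<Prod>e'\<in>Ev. g e' (C \<inter> (e' - {v}))) = (\<Prod>e'\<in>Ev. \<Sum>C\<in>Pow (e' - {v}). g e' C)"
        unfolding U_def by (rule sum_Pow_UN_disjoint_prod[OF finEv disj])
      also have "\<dots> = (\<Sum>C\<in>Pow (e - {v}). g e C) * (\<Prod>e'\<in>Ev - {e}. \<Sum>C\<in>Pow (e' - {v}). g e' C)"
        using finEv e by (rule prod.remove)
      also have "\<dots> = \<gamma> e * prod \<alpha> (Ev - {e})"
      proof -
        have "(\<Sum>C\<in>Pow (e - {v}). g e C) = \<gamma> e" by (simp add: g_def \<gamma>_def)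
        moreover have "(\<Prod>e'\<in>Ev - {e}. \<Sum>C\<in>Pow (e' - {v}). g e' C) = prod \<alpha> (Ev - {e})"
          unfolding \<alpha>_def g_def by (rule prod.cong) auto
        ultimately show ?thesis by simp
      qed
      finally show ?thesis .
    qed
    then show ?thesis
      by (subst sum_distrib_left, subst sum.swap) (simp add: sum_distrib_left)
  qed
  have nonneg: "0 \<le> \<alpha> e" "0 \<le> \<beta> e" "0 \<le> \<gamma> e" for e
    using h0 t by (auto simp: \<alpha>_def \<beta>_def \<gamma>_def intro!: sum_nonneg mult_nonneg_nonneg)
  show ?thesis
  \<comment> \<open>If some \<open>\<alpha> e\<close> vanishes, the left side is not positive;
    otherwise the quotients \<open>\<gamma> e / \<alpha> e\<close> are available and the triple
    estimates can be multiplied.\<close>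
  proof (cases "\<exists>e\<in>Ev. \<alpha> e = 0")
    case True
    then have "prod \<alpha> Ev = 0" using finEv by auto
    moreover have "0 \<le> w0 * (\<Sum>e\<in>Ev. \<gamma> e * prod \<alpha> (Ev - {e}))" "0 \<le> w0 * prod \<beta> Ev"
      using w0 nonneg by (auto intro!: mult_nonneg_nonneg sum_nonneg prod_nonneg)
    moreover have "0 \<le> exp (-s) * (2 * x)" if "0 \<le> x" for x :: real using that by simp
    ultimately have "0 \<le> exp (-s) * (2 * (w0 * (\<Sum>e\<in>Ev. \<gamma> e * prod \<alpha> (Ev - {e}))))"
      "0 \<le> w0 * prod \<beta> Ev" "prod \<alpha> Ev = 0" by blast+
    then show ?thesis
      unfolding A B G by (simp only: mult_zero_right diff_0 mult_minus_right)
  next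
    case False
    then have pos: "0 < \<alpha> e" if "e \<in> Ev" for e using nonneg(1)[of e] that by force
    have "\<alpha> e * exp (- 2 * (\<gamma> e / \<alpha> e)) \<le> \<beta> e" if "e \<in> Ev" for e
      unfolding \<alpha>_def \<beta>_def \<gamma>_def
    proof (rule triple_estimate[where h = "h e", OF _ t h0 hmono])
      show "card (e - {v}) = 3" using that edge_card finite_edge by (auto simp: Ev_def)
      show "0 < (\<Sum>C\<in>Pow (e - {v}). h e C * penalty t (card C))" using pos[OF that] by (simp add: \<alpha>_def)
    qed
    then have prod_le: "(\<Prod>e\<in>Ev. \<alpha> e * exp (- 2 * (\<gamma> e / \<alpha> e))) \<le> prod \<beta> Ev"
      using nonneg by (intro prod_mono) auto
    define S where "S = (\<Sum>e\<in>Ev. \<gamma> e / \<alpha> e)"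
    have S: "prod \<alpha> Ev * S = (\<Sum>e\<in>Ev. \<gamma> e * prod \<alpha> (Ev - {e}))"
      unfolding S_def sum_distrib_left
    proof (intro sum.cong refl)
      fix e assume e: "e \<in> Ev"
      show "prod \<alpha> Ev * (\<gamma> e / \<alpha> e) = \<gamma> e * prod \<alpha> (Ev - {e})"
        using pos[OF e] by (subst prod.remove[OF finEv e]) simp
    qed
    have "exp (-s) * ((1 + s) * prod \<alpha> Ev - 2 * (\<Sum>e\<in>Ev. \<gamma> e * prod \<alpha> (Ev - {e}))) =
        prod \<alpha> Ev * (exp (-s) * (1 + s - 2 * S))"
      by (simp add: algebra_simps flip: S)
    also have "\<dots> \<le> prod \<alpha> Ev * exp (- (2 * S))"
      using nonneg by (intro mult_left_mono exp_minus_tangent prod_nonneg) auto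
    also have "\<dots> = (\<Prod>e\<in>Ev. \<alpha> e * exp (- 2 * (\<gamma> e / \<alpha> e)))"
      using finEv by (simp add: S_def prod.distrib exp_sum[symmetric] sum_distrib_left sum_negf)
    also note prod_le
    finally have "exp (-s) * ((1 + s) * prod \<alpha> Ev - 2 * (\<Sum>e\<in>Ev. \<gamma> e * prod \<alpha> (Ev - {e}))) \<le> prod \<beta> Ev" .
    then have "w0 * (exp (-s) * ((1 + s) * prod \<alpha> Ev - 2 * (\<Sum>e\<in>Ev. \<gamma> e * prod \<alpha> (Ev - {e})))) \<le> w0 * prod \<beta> Ev"
      using w0 by (intro mult_left_mono)
    then show ?thesis unfolding A B G by (simp add: algebra_simps)
  qed
qed

text \<open>The conditional bound is linear in the two sums and therefore adds up over all
  \<open>J\<close>; for this reason \<open>s\<close> stays free instead of being a conditional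
  mean.\<close>

lemma vertex_estimate:
  assumes t: "0 \<le> t"
  shows "exp (-s) * ((1 + s) * (\<Sum>I\<in>Pow (V - {v}). weight t I)
      - 2 * (\<Sum>I\<in>Pow (V - {v}). weight t I * (\<Sum>e | e \<in> E \<and> v \<in> e. t ^ (3 - card (e \<inter> I)))))
    \<le> (\<Sum>I\<in>Pow (V - {v}). weight t (insert v I))"
proof -
  define U where "U = (\<Union>e\<in>{e \<in> E. v \<in> e}. e - {v})"
  define W where "W = V - {v} - U"
  have V: "V - {v} = W \<union> U" "W \<inter> U = {}"
    using edge_subset by (auto simp: W_def U_def)
  let ?g = "\<lambda>I. \<Sum>e | e \<in> E \<and> v \<in> e. t ^ (3 - card (e \<inter> I))"
  have "(\<Sum>J\<in>Pow W. exp (-s) * ((1 + s) * (\<Sum>C\<in>Pow U. weight t (J \<union> C))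
      - 2 * (\<Sum>C\<in>Pow U. weight t (J \<union> C) * ?g (J \<union> C))))
    \<le> (\<Sum>J\<in>Pow W. \<Sum>C\<in>Pow U. weight t (insert v (J \<union> C)))"
    unfolding W_def U_def by (intro sum_mono vertex_estimate_conditional[OF t]) auto
  then show ?thesis
    unfolding V(1) sum_Pow_Un_disjoint[OF V(2)]
    by (simp only: sum_distrib_left[symmetric] sum_subtractf)
qed

lemma weight_nonzero:
  assumes "I \<subseteq> V" "weight t I \<noteq> 0"
  shows "e \<in> E \<Longrightarrow> card (e \<inter> I) \<le> 3"
    and "weight t I = exp (- (\<Sum>e\<in>E. energy t (card (e \<inter> I))))"
proof -
  have *: "card (e \<inter> I) \<le> 3" if "e \<in> E" for e
    using assms finite_E that by (force simp: weight_def penalty_def split: if_splits)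
  then show "e \<in> E \<Longrightarrow> card (e \<inter> I) \<le> 3" .
  show "weight t I = exp (- (\<Sum>e\<in>E. energy t (card (e \<inter> I))))"
    using finite_E * by (simp add: weight_def penalty_def sum_negf[symmetric] exp_sum)
qed

text \<open>Gibbs' inequality against the product measure that picks each vertex with odds \<open>p\<close>.\<close>

lemma energy_sum_le:
  fixes p :: real
  assumes p: "0 < p" "p \<le> 1"
    and small: "\<And>I. \<lbrakk>I \<subseteq> V; weight t I \<noteq> 0\<rbrakk> \<Longrightarrow> card I \<le> p * card V"
  shows "(\<Sum>I\<in>Pow V. weight t I * (\<Sum>e\<in>E. energy t (card (e \<inter> I))))
    \<le> card V * (p * (1 - ln p)) * (\<Sum>I\<in>Pow V. weight t I)"
proof -
  define Z where "Z = (\<Sum>I\<in>Pow V. weight t I)"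
  define Q where "Q = (\<Sum>I\<in>Pow V. p ^ card I)"
  define en where "en I = (\<Sum>e\<in>E. energy t (card (e \<inter> I)))" for I
  have "weight t {} \<le> Z"
    unfolding Z_def using finite_V by (intro member_le_sum) auto
  then have Z: "1 \<le> Z" by simp
  have Q: "Q = (1 + p) ^ card V"
    unfolding Q_def by (rule sum_power_card_Pow[OF finite_V])
  have Q0: "0 < Q" using p by (simp add: Q)
  have lnQ: "ln Q \<le> p * card V"
    using p mult_left_mono[OF ln_add_one_self_le_self[of p], of "card V"]
    by (simp add: Q ln_realpow mult.commute)
  \<comment> \<open>Gibbs' inequality before summation: the last bracket sums to 0 over all
    \<open>I\<close>, since the product measure and the Gibbs measure have the same total
    mass.\<close>
  have "weight t I * en I \<le> weight t I * (card V * (p * (1 - ln p))) + (p ^ card I * Z / Q - weight t I)"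
    if I: "I \<in> Pow V" for I
  proof (cases "weight t I = 0")
    case True
    then show ?thesis using p Z Q0 by simp
  next
    case False
    define w where "w = weight t I"
    have w: "0 < w" using False weight_nonneg[of t I] unfolding w_def by linarith
    have lnw: "ln w = - en I"
      using weight_nonzero(2)[of I t] False I by (simp add: w_def en_def)
    \<comment> \<open>The bound \<open>ln x \<le> x - 1\<close> at the ratio of the two densities
      \<open>p ^ card I / Q\<close> and \<open>w / Z\<close>.\<close>
    have "ln (p ^ card I * Z / (w * Q)) \<le> p ^ card I * Z / (w * Q) - 1"
      using p Z Q0 w by (intro ln_le_minus_one) auto
    then have "card I * ln p + ln Z + en I - ln Q \<le> p ^ card I * Z / (w * Q) - 1"
      using p Z Q0 w lnw by (simp add: ln_div ln_mult ln_realpow)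
    \<comment> \<open>As \<open>ln p\<close> is not positive, the upper bound on
      \<open>card I\<close> turns into a lower bound here.\<close>
    moreover have "p * card V * ln p \<le> card I * ln p"
      using small[of I] False I p by (intro mult_right_mono_neg) auto
    moreover have "0 \<le> ln Z" using Z by simp
    ultimately have "en I \<le> card V * (p * (1 - ln p)) + (p ^ card I * Z / (w * Q) - 1)"
      using lnQ by (simp add: algebra_simps)
    then have "w * en I \<le> w * (card V * (p * (1 - ln p)) + (p ^ card I * Z / (w * Q) - 1))"
      using w by (intro mult_left_mono) auto
    also have "\<dots> = w * (card V * (p * (1 - ln p))) + (p ^ card I * Z / Q - w)"
      using w by (simp add: distrib_left right_diff_distrib)
    finally show ?thesis unfolding w_def .
  qed
  then have "(\<Sum>I\<in>Pow V. weight t I * en I) \<le>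
      (\<Sum>I\<in>Pow V. weight t I * (card V * (p * (1 - ln p))) + (p ^ card I * Z / Q - weight t I))"
    by (rule sum_mono)
  also have "\<dots> = Z * (card V * (p * (1 - ln p))) + (Q * Z / Q - Z)"
    unfolding Z_def Q_def by (simp add: sum.distrib sum_subtractf sum_distrib_right sum_divide_distrib)
  also have "\<dots> = card V * (p * (1 - ln p)) * Z" using Q0 by simp
  finally show ?thesis unfolding Z_def en_def .
qed

text \<open>\<open>X\<close> is the scale of the expected energy increment per vertex. The condition
  with \<open>D\<close> keeps that increment of order \<open>X\<close>, and the exponential
  condition then pushes the mean size of the random set up to \<open>p * card V\<close>, against the
  assumption that all independent sets are smaller.\<close>

theorem large_independent_set:
  fixes p D X :: real
  assumes V: "V \<noteq> {}"
    and D: "real (card E) \<le> D * card V"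
    and p: "0 < p" "p \<le> 1"
    and X: "0 < X" "D * (p * (1 - ln p)) ^ 3 \<le> X ^ 4" "2 * p \<le> exp (- 32 * X)"
  shows "\<exists>I\<subseteq>V. (\<forall>e\<in>E. \<not> e \<subseteq> I) \<and> p * card V \<le> card I"
proof (rule ccontr)
  assume contra: "\<not> ?thesis"
  define N where "N = real (card V)"
  define Y where "Y = p * (1 - ln p)"
  \<comment> \<open>This \<open>t\<close> balances the two error terms below:
    \<open>t ^ 3 * card E\<close> and the mean energy divided by \<open>t\<close> are both at most
    \<open>X * N\<close>.\<close>
  define t where "t = Y / X"
  define Z where "Z = (\<Sum>I\<in>Pow V. weight t I)"
  define en where "en I = (\<Sum>e\<in>E. energy t (card (e \<inter> I)))" for I
  define G where "G I v = (\<Sum>e | e \<in> E \<and> v \<in> e. t ^ (3 - card (e \<inter> I)))" for I v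
  have N: "0 < N" using V finite_V by (simp add: N_def card_gt_0_iff)
  have "ln p \<le> 0" using p by simp
  then have "0 < 1 - ln p" by linarith
  then have Y: "0 < Y" unfolding Y_def using p(1) by (rule mult_pos_pos[rotated])
  have t: "0 < t" using X Y by (simp add: t_def)
  have small: "card I < p * N" if "I \<subseteq> V" "weight t I \<noteq> 0" for I
  proof -
    have "\<not> e \<subseteq> I" if "e \<in> E" for e
    proof
      assume "e \<subseteq> I"
      then have "e \<inter> I = e" by blast
      then show False
        using weight_nonzero(1)[OF \<open>I \<subseteq> V\<close> \<open>weight t I \<noteq> 0\<close> that] edge_card[OF that] by simp
    qed
    then have "\<not> p * card V \<le> card I" using contra that(1) by blast
    then show ?thesis by (simp add: N_def)
  qed
  have "(\<Sum>I\<in>Pow V. weight t I * en I) \<le> card V * (p * (1 - ln p)) * Z"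
    unfolding en_def Z_def using small by (intro energy_sum_le p) (auto simp: N_def less_imp_le)
  then have energy: "(\<Sum>I\<in>Pow V. weight t I * en I) \<le> N * Y * Z"
    by (simp add: N_def Y_def)
  have Z0: "0 \<le> Z" by (simp add: Z_def sum_nonneg)
  \<comment> \<open>Expected increment summed over all vertices. Each edge is counted at its four
    vertices, and there are two error terms of size \<open>X * N * Z\<close>, hence the 8.\<close>
  have pairs: "(\<Sum>I\<in>Pow V. weight t I * (\<Sum>v\<in>V. G I v)) \<le> 8 * X * N * Z"
  proof -
    have "weight t I * (\<Sum>v\<in>V. G I v) \<le> weight t I * (4 * (t ^ 3 * card E + en I / t))"
      if I: "I \<in> Pow V" for I
    proof (cases "weight t I = 0")
      case False
      have "(\<Sum>v\<in>V. G I v) = (\<Sum>e\<in>E. \<Sum>v | v \<in> V \<and> v \<in> e. t ^ (3 - card (e \<inter> I)))"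
        unfolding G_def by (rule sum.swap_restrict[OF finite_V finite_E])
      also have "\<dots> = (\<Sum>e\<in>E. 4 * t ^ (3 - card (e \<inter> I)))"
      proof (rule sum.cong[OF refl])
        fix e assume e: "e \<in> E"
        then have "{v \<in> V. v \<in> e} = e" using edge_subset by auto
        then show "(\<Sum>v | v \<in> V \<and> v \<in> e. t ^ (3 - card (e \<inter> I))) = 4 * t ^ (3 - card (e \<inter> I))"
          using edge_card[OF e] by simp
      qed
      also have "\<dots> \<le> (\<Sum>e\<in>E. 4 * (t ^ 3 + energy t (card (e \<inter> I)) / t))"
        using weight_nonzero(1)[OF _ False] I t by (intro sum_mono mult_left_mono power_le_energy) auto
      also have "\<dots> = 4 * (t ^ 3 * card E + en I / t)"
        by (simp add: en_def sum.distrib sum_divide_distrib sum_distrib_left)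
      finally show ?thesis by (intro mult_left_mono) auto
    qed simp
    then have "(\<Sum>I\<in>Pow V. weight t I * (\<Sum>v\<in>V. G I v)) \<le>
        (\<Sum>I\<in>Pow V. weight t I * (4 * (t ^ 3 * card E + en I / t)))"
      by (rule sum_mono)
    also have "\<dots> = 4 * (t ^ 3 * card E * Z + (\<Sum>I\<in>Pow V. weight t I * en I) / t)"
      by (simp add: Z_def algebra_simps sum.distrib sum_divide_distrib sum_distrib_left)
    also have "\<dots> \<le> 4 * (X * N * Z + X * N * Z)"
    proof (intro mult_left_mono add_mono)
      have "t ^ 3 * card E \<le> t ^ 3 * (D * N)"
        using D t by (intro mult_left_mono) (auto simp: N_def)
      also have "\<dots> = D * Y ^ 3 * N / X ^ 3" by (simp add: t_def power_divide)
      also have "\<dots> \<le> X ^ 4 * N / X ^ 3"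
        using X N by (intro divide_right_mono mult_right_mono) (auto simp: Y_def)
      also have "\<dots> = X * N" using X by (simp add: eval_nat_numeral)
      finally show "t ^ 3 * card E * Z \<le> X * N * Z" using Z0 by (rule mult_right_mono)
      have "(\<Sum>I\<in>Pow V. weight t I * en I) / t \<le> N * Y * Z / t"
        using energy t by (intro divide_right_mono) auto
      also have "\<dots> = X * N * Z" using X Y by (simp add: t_def)
      finally show "(\<Sum>I\<in>Pow V. weight t I * en I) / t \<le> X * N * Z" .
    qed simp
    finally show ?thesis by (simp add: algebra_simps)
  qed
  \<comment> \<open>With this value \<open>N * s * (Z / 2)\<close> equals the loss
    \<open>2 * (8 * X * N * Z)\<close>, so that exactly \<open>N * Z / 2\<close> remains.\<close>
  define s where "s = 32 * X"
  have s: "0 < s" using X by (simp add: s_def)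
  \<comment> \<open>Removing \<open>v\<close> never lowers the weight, so the sets avoiding
    \<open>v\<close> carry at least half of \<open>Z\<close>.\<close>
  have lower: "exp (-s) * ((1 + s) * (Z / 2) - 2 * (\<Sum>I\<in>Pow V. weight t I * G I v))
      \<le> (\<Sum>I\<in>{I \<in> Pow V. v \<in> I}. weight t I)" if v: "v \<in> V" for v
  proof -
    have V_eq: "V = (V - {v}) \<union> {v}" "(V - {v}) \<inter> {v} = {}" using v by auto
    have "Z = (\<Sum>I\<in>Pow (V - {v}). weight t I + weight t (insert v I))"
      unfolding Z_def by (subst V_eq(1), subst sum_Pow_Un_disjoint[OF V_eq(2)]) (simp add: Pow_insert add.commute)
    also have "\<dots> \<le> (\<Sum>I\<in>Pow (V - {v}). weight t I + weight t I)"
      using t by (intro sum_mono add_left_mono weight_antimono) auto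
    finally have half: "Z / 2 \<le> (\<Sum>I\<in>Pow (V - {v}). weight t I)"
      by (simp flip: sum_distrib_left)
    have G0: "0 \<le> G I v" for I using t by (simp add: G_def sum_nonneg)
    have "(\<Sum>I\<in>Pow (V - {v}). weight t I * G I v) \<le> (\<Sum>I\<in>Pow V. weight t I * G I v)"
      using finite_V G0 by (intro sum_mono2) auto
    then have "exp (-s) * ((1 + s) * (Z / 2) - 2 * (\<Sum>I\<in>Pow V. weight t I * G I v)) \<le>
        exp (-s) * ((1 + s) * (\<Sum>I\<in>Pow (V - {v}). weight t I)
          - 2 * (\<Sum>I\<in>Pow (V - {v}). weight t I * G I v))"
      using half s by (intro mult_left_mono diff_mono) auto
    also have "\<dots> \<le> (\<Sum>I\<in>Pow (V - {v}). weight t (insert v I))"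
      unfolding G_def using t by (intro vertex_estimate) simp
    also have "\<dots> = (\<Sum>I\<in>{I \<in> Pow V. v \<in> I}. weight t I)"
      by (rule sum.reindex_bij_witness[of _ "\<lambda>I. I - {v}" "insert v"]) (use v in \<open>auto simp: insert_absorb\<close>)
    finally show ?thesis .
  qed
  have "exp (-s) * (N * Z / 2) = exp (-s) * (N * ((1 + s) * (Z / 2)) - 2 * (8 * X * N * Z))"
    by (simp add: s_def algebra_simps)
  also have "\<dots> \<le> exp (-s) * (N * ((1 + s) * (Z / 2)) - 2 * (\<Sum>I\<in>Pow V. weight t I * (\<Sum>v\<in>V. G I v)))"
  proof (rule mult_left_mono)
    show "N * ((1 + s) * (Z / 2)) - 2 * (8 * X * N * Z) \<le>
        N * ((1 + s) * (Z / 2)) - 2 * (\<Sum>I\<in>Pow V. weight t I * (\<Sum>v\<in>V. G I v))"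
      using pairs by linarith
  qed simp
  also have "(\<Sum>I\<in>Pow V. weight t I * (\<Sum>v\<in>V. G I v)) = (\<Sum>v\<in>V. \<Sum>I\<in>Pow V. weight t I * G I v)"
    by (subst sum.swap) (simp add: sum_distrib_left)
  also have "exp (-s) * (N * ((1 + s) * (Z / 2)) - 2 * (\<Sum>v\<in>V. \<Sum>I\<in>Pow V. weight t I * G I v)) =
      (\<Sum>v\<in>V. exp (-s) * ((1 + s) * (Z / 2) - 2 * (\<Sum>I\<in>Pow V. weight t I * G I v)))"
    by (simp only: sum_distrib_left[symmetric] sum_subtractf sum_constant N_def) (simp add: algebra_simps)
  also have "\<dots> \<le> (\<Sum>v\<in>V. \<Sum>I\<in>{I \<in> Pow V. v \<in> I}. weight t I)"
    by (intro sum_mono lower)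
  also have "\<dots> = (\<Sum>I\<in>Pow V. \<Sum>v | v \<in> V \<and> v \<in> I. weight t I)"
    using finite_V by (intro sum.swap_restrict) auto
  also have "\<dots> = (\<Sum>I\<in>Pow V. weight t I * card I)"
  proof (rule sum.cong[OF refl])
    fix I assume "I \<in> Pow V"
    then have "{v \<in> V. v \<in> I} = I" by auto
    then show "(\<Sum>v | v \<in> V \<and> v \<in> I. weight t I) = weight t I * card I" by simp
  qed
  also have "\<dots> < (\<Sum>I\<in>Pow V. weight t I * (p * N))"
  proof (rule sum_strict_mono_ex1)
    show "finite (Pow V)" using finite_V by simp
    show "\<forall>I\<in>Pow V. weight t I * card I \<le> weight t I * (p * N)"
    proof
      fix I assume "I \<in> Pow V"
      then show "weight t I * card I \<le> weight t I * (p * N)"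
        using small[of I] by (cases "weight t I = 0") (auto intro!: mult_left_mono)
    qed
    \<comment> \<open>The empty set has weight 1 and size 0, which makes the comparison
      strict.\<close>
    show "\<exists>I\<in>Pow V. weight t I * card I < weight t I * (p * N)"
      using p N by (intro bexI[of _ "{}"]) auto
  qed
  also have "\<dots> = p * N * Z" by (simp add: Z_def mult.commute sum_distrib_left)
  also have "\<dots> \<le> exp (-s) / 2 * N * Z"
    using X(3) N Z0 by (intro mult_right_mono) (auto simp: s_def)
  finally show False by simp
qed

end

section \<open>Passing to a sparse sub-hypergraph\<close>

text \<open>The probability that \<open>F\<close> survives when each point is kept independently
  with probability \<open>p\<close>. It is found by giving the points of \<open>F\<close> exclusion
  weight 0 and expanding a product over \<open>V\<close>.\<close>

lemma sum_random_subset: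
  fixes p :: "'b::comm_ring_1"
  assumes "finite V" "F \<subseteq> V"
  shows "(\<Sum>W\<in>Pow V. p ^ card W * (1 - p) ^ card (V - W) * (if F \<subseteq> W then 1 else 0)) = p ^ card F"
proof -
  let ?g = "\<lambda>i. if i \<in> F then 0 else 1 - p"
  have prods: "(\<Prod>i\<in>V - W. ?g i) = (1 - p) ^ card (V - W) * (if F \<subseteq> W then 1 else 0)" if "W \<subseteq> V" for W
  proof (cases "F \<subseteq> W")
    case True
    then have "(\<Prod>i\<in>V - W. ?g i) = (\<Prod>i\<in>V - W. 1 - p)" by (intro prod.cong) auto
    then show ?thesis using True by simp
  next
    case False
    then obtain i where "i \<in> F" "i \<notin> W" by blast
    then have "\<exists>i\<in>V - W. ?g i = 0" using assms(2) by (intro bexI[of _ i]) auto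
    then have "(\<Prod>i\<in>V - W. ?g i) = 0" using assms(1) by (intro prod_zero) simp_all
    then show ?thesis using False by simp
  qed
  have "(\<Sum>W\<in>Pow V. p ^ card W * (1 - p) ^ card (V - W) * (if F \<subseteq> W then 1 else 0)) =
      (\<Sum>W\<in>Pow V. (\<Prod>i\<in>W. p) * (\<Prod>i\<in>V - W. ?g i))"
    using prods by (intro sum.cong) (auto simp: mult.assoc)
  also have "\<dots> = (\<Prod>i\<in>V. p + ?g i)"
    by (rule prod_add[OF assms(1), symmetric])
  also have "\<dots> = (\<Prod>i\<in>V. if i \<in> F then p else 1)" by (intro prod.cong) auto
  also have "\<dots> = p ^ card F"
    using assms by (simp add: prod.If_cases Int_absorb1)
  finally show ?thesis .
qed

lemma sum_random_subset_family:
  fixes p :: "'b::comm_ring_1"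
  assumes "finite V" "\<And>F. F \<in> H \<Longrightarrow> h F \<subseteq> V"
  shows "(\<Sum>W\<in>Pow V. p ^ card W * (1 - p) ^ card (V - W) * (\<Sum>F\<in>H. if h F \<subseteq> W then 1 else 0)) =
    (\<Sum>F\<in>H. p ^ card (h F))"
proof -
  have "(\<Sum>W\<in>Pow V. p ^ card W * (1 - p) ^ card (V - W) * (\<Sum>F\<in>H. if h F \<subseteq> W then 1 else 0)) =
      (\<Sum>F\<in>H. \<Sum>W\<in>Pow V. p ^ card W * (1 - p) ^ card (V - W) * (if h F \<subseteq> W then 1 else 0))"
    unfolding sum_distrib_left by (rule sum.swap)
  also have "\<dots> = (\<Sum>F\<in>H. p ^ card (h F))"
    using assms by (intro sum.cong refl sum_random_subset) auto
  finally show ?thesis .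
qed

text \<open>Some \<open>W\<close> reaches the mean of points minus \<open>a\<close> times edges
  minus bad sets. Deleting one point from each bad set inside \<open>W\<close> costs at most the
  number of these sets and creates no edge. The weight \<open>a\<close> makes one inequality control
  both the points and the edges that remain.\<close>

lemma deletion_method:
  fixes p a :: real
  assumes V: "finite V" and E: "E \<subseteq> Pow V" and B: "B \<subseteq> Pow V" "{} \<notin> B"
    and p: "0 \<le> p" "p \<le> 1" and a: "0 \<le> a"
  shows "\<exists>U\<subseteq>V. (\<forall>X\<in>B. \<not> X \<subseteq> U) \<and>
    p * card V - a * (\<Sum>e\<in>E. p ^ card e) - (\<Sum>X\<in>B. p ^ card X) \<le> card U - a * card {e \<in> E. e \<subseteq> U}"
proof -
  define \<mu> where "\<mu> W = p ^ card W * (1 - p) ^ card (V - W)" for W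
  define g where "g W = (\<Sum>v\<in>V. if {v} \<subseteq> W then 1 else 0) - a * (\<Sum>e\<in>E. if e \<subseteq> W then 1 else 0)
      - (\<Sum>X\<in>B. if X \<subseteq> W then 1 else (0::real))" for W
  define r where "r = p * card V - a * (\<Sum>e\<in>E. p ^ card e) - (\<Sum>X\<in>B. p ^ card X)"
  have fin: "finite E" "finite B" using V E B by (meson finite_Pow_iff finite_subset)+
  have \<mu>0: "0 \<le> \<mu> W" for W using p by (simp add: \<mu>_def)
  have total: "sum \<mu> (Pow V) = 1"
    using sum_random_subset[OF V, of "{}" p] by (simp add: \<mu>_def)
  have points: "(\<Sum>W\<in>Pow V. \<mu> W * (\<Sum>v\<in>V. if {v} \<subseteq> W then 1 else 0)) = (\<Sum>v\<in>V. p ^ card {v})"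
    unfolding \<mu>_def by (rule sum_random_subset_family[OF V]) simp
  have sets: "(\<Sum>W\<in>Pow V. \<mu> W * (\<Sum>X\<in>H. if X \<subseteq> W then 1 else 0)) = (\<Sum>X\<in>H. p ^ card X)"
    if "H \<subseteq> Pow V" for H
    unfolding \<mu>_def by (rule sum_random_subset_family[OF V]) (use that in auto)
  have mean: "(\<Sum>W\<in>Pow V. \<mu> W * g W) = r"
  proof -
    have scale: "(\<Sum>W\<in>Pow V. \<mu> W * (a * b W)) = a * (\<Sum>W\<in>Pow V. \<mu> W * b W)" for b
      by (simp add: sum_distrib_left mult.left_commute)
    have "(\<Sum>W\<in>Pow V. \<mu> W * g W) =
        (\<Sum>W\<in>Pow V. \<mu> W * (\<Sum>v\<in>V. if {v} \<subseteq> W then 1 else 0)) -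
        a * (\<Sum>W\<in>Pow V. \<mu> W * (\<Sum>e\<in>E. if e \<subseteq> W then 1 else 0)) -
        (\<Sum>W\<in>Pow V. \<mu> W * (\<Sum>X\<in>B. if X \<subseteq> W then 1 else 0))"
      unfolding g_def right_diff_distrib sum_subtractf scale ..
    also have "\<dots> = r"
      unfolding points sets[OF E] sets[OF B(1)] by (simp add: r_def mult.commute)
    finally show ?thesis .
  qed
  have "\<exists>W\<in>Pow V. r \<le> g W"
  proof (rule ccontr)
    assume "\<not> ?thesis"
    then have "\<forall>W\<in>Pow V. g W < r" by (simp only: bex_simps not_le ball_simps)
    then have less: "0 < r - g W" if "W \<in> Pow V" for W using that by simp
    have "(\<Sum>W\<in>Pow V. \<mu> W * (r - g W)) = 0"
      using mean total by (simp add: right_diff_distrib sum_subtractf flip: sum_distrib_right)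
    moreover have "0 \<le> \<mu> W * (r - g W)" if "W \<in> Pow V" for W
      using \<mu>0 less[OF that] by simp
    ultimately have "\<forall>W\<in>Pow V. \<mu> W * (r - g W) = 0"
      using sum_nonneg_eq_0_iff[of "Pow V" "\<lambda>W. \<mu> W * (r - g W)"] V by blast
    then have "\<mu> W = 0" if "W \<in> Pow V" for W using less[OF that] that by auto
    then have "sum \<mu> (Pow V) = 0" by (intro sum.neutral ballI)
    then show False using total by simp
  qed
  then obtain W where W: "W \<subseteq> V" "r \<le> g W" by auto
  obtain pick where pick: "pick X \<in> X" if "X \<in> B" for X
    using B(2) by (metis ex_in_conv)
  define BW where "BW = {X \<in> B. X \<subseteq> W}"
  define U where "U = W - pick ` BW"
  have finW: "finite W" "finite BW" using W V fin finite_subset by (auto simp: BW_def)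
  have "card W - card (pick ` BW) \<le> card U"
    unfolding U_def using finW by (intro diff_card_le_card_Diff) auto
  then have "card W \<le> card U + card BW" using card_image_le[OF finW(2), of pick] by linarith
  moreover have "card {e \<in> E. e \<subseteq> U} \<le> card {e \<in> E. e \<subseteq> W}"
    using fin by (intro card_mono) (auto simp: U_def)
  moreover have "g W = card W - a * card {e \<in> E. e \<subseteq> W} - card BW"
  proof -
    have "V \<inter> {v. {v} \<subseteq> W} = W" using W by auto
    then show ?thesis
      using V fin by (simp add: g_def BW_def sum.If_cases Int_def)
  qed
  ultimately have "r \<le> card U - a * card {e \<in> E. e \<subseteq> U}"
    using W(2) mult_left_mono[of "real (card {e \<in> E. e \<subseteq> U})" "card {e \<in> E. e \<subseteq> W}" a] a by simp
  moreover have "\<not> X \<subseteq> U" if "X \<in> B" for X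
    using pick[OF that] that by (auto simp: U_def BW_def)
  moreover have "U \<subseteq> V" using W by (auto simp: U_def)
  ultimately show ?thesis unfolding r_def by blast
qed

lemma card_le_mult_cover:
  assumes "finite I" "card I \<le> m" "\<And>i. i \<in> I \<Longrightarrow> finite (A i) \<and> card (A i) \<le> k" "B \<subseteq> (\<Union>i\<in>I. A i)"
  shows "finite B \<and> card B \<le> m * k"
proof
  have fin: "finite (\<Union>i\<in>I. A i)" using assms by simp
  then show "finite B" using assms(4) by (rule rev_finite_subset)
  have "card B \<le> card (\<Union>i\<in>I. A i)" using fin assms(4) by (rule card_mono)
  also have "\<dots> \<le> (\<Sum>i\<in>I. card (A i))" by (rule card_UN_le[OF assms(1)])
  also have "\<dots> \<le> card I * k" using sum_bounded_above[of I "\<lambda>i. card (A i)" k] assms(3) by simp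
  also have "\<dots> \<le> m * k" using assms(2) by (rule mult_le_mono1)
  finally show "card B \<le> m * k" .
qed

text \<open>The powers 6, 5 and 9 of \<open>p\<close> belong to the bad configurations: two edges
  sharing 2 points span 6 points, two sharing 3 points span 5, and a triangle with pairwise
  intersections of at most one point spans at least 9. Their numbers follow from the
  degrees.\<close>

lemma sparse_subhypergraph:
  fixes p a :: real and V :: "'a set"
  assumes V: "finite V" and E: "E \<subseteq> Pow V" and E4: "\<And>e. e \<in> E \<Longrightarrow> card e = 4"
    and deg1: "\<And>x. x \<in> V \<Longrightarrow> card {e \<in> E. x \<in> e} \<le> d1"
    and deg2: "\<And>x y. x \<noteq> y \<Longrightarrow> card {e \<in> E. x \<in> e \<and> y \<in> e} \<le> d2"
    and deg3: "\<And>x y z. distinct [x, y, z] \<Longrightarrow> card {e \<in> E. x \<in> e \<and> y \<in> e \<and> z \<in> e} \<le> d3"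
    and p: "0 \<le> p" "p \<le> 1" and a: "0 \<le> a"
  shows "\<exists>U\<subseteq>V. sparse_hypergraph U {e \<in> E. e \<subseteq> U} \<and>
    card V * (p - a * real d1 * p ^ 4 - 16 * real d1 * real d2 * p ^ 6
      - 64 * real d1 * real d3 * p ^ 5 - 16 * (real d1)\<^sup>2 * real d2 * p ^ 9)
      \<le> card U - a * card {e \<in> E. e \<subseteq> U}"
proof -
  define B2 where "B2 = {e \<union> f | e f. e \<in> E \<and> f \<in> E \<and> card (e \<inter> f) = 2}"
  define B3 where "B3 = {e \<union> f | e f. e \<in> E \<and> f \<in> E \<and> card (e \<inter> f) = 3}"
  \<comment> \<open>The bounds on the intersections guarantee nine points; a triangle of distinct
    edges that violates them contains a member of \<open>B2\<close> or \<open>B3\<close>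
    already.\<close>
  define B4 where "B4 = {e \<union> e' \<union> f | e e' f v. e \<in> E \<and> e' \<in> E \<and> f \<in> E \<and> v \<in> e \<and> v \<in> e' \<and> v \<notin> f \<and>
      f \<inter> e \<noteq> {} \<and> f \<inter> e' \<noteq> {} \<and> card (e \<inter> e') \<le> 1 \<and> card (f \<inter> e) \<le> 1 \<and> card (f \<inter> e') \<le> 1}"
  have finE: "finite E" using V E by (meson finite_Pow_iff finite_subset)
  have fine: "finite e" if "e \<in> E" for e using E4[OF that] card.infinite by fastforce
  have cardE: "card E \<le> card V * d1"
  proof (rule card_le_mult_cover[OF V order.refl, THEN conjunct2])
    show "E \<subseteq> (\<Union>x\<in>V. {e \<in> E. x \<in> e})"
    proof
      fix e assume e: "e \<in> E"
      then have "e \<noteq> {}" using E4[OF e] by auto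
      then obtain x where "x \<in> e" by blast
      then show "e \<in> (\<Union>x\<in>V. {e \<in> E. x \<in> e})" using e E by blast
    qed
  qed (use deg1 finE in simp)
  have subV: "B2 \<union> B3 \<union> B4 \<subseteq> Pow V" using E by (auto simp: B2_def B3_def B4_def)
  then have fin: "finite B2" "finite B3" "finite B4"
    using V by (auto intro: finite_subset[OF _ finite_Pow_iff[THEN iffD2, OF V]])
  \<comment> \<open>There are 4 * 4 pairs from \<open>e\<close> and \<open>e'\<close>, and a pair of
    distinct points lies in at most \<open>d2\<close> edges. The case \<open>e = e'\<close> serves
    \<open>B2\<close>, two edges at a common vertex serve \<open>B4\<close>.\<close>
  have link2: "finite (\<Union>i\<in>{i \<in> e \<times> e'. fst i \<noteq> snd i}. (\<union>) X ` {f \<in> E. fst i \<in> f \<and> snd i \<in> f}) \<and>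
      card (\<Union>i\<in>{i \<in> e \<times> e'. fst i \<noteq> snd i}. (\<union>) X ` {f \<in> E. fst i \<in> f \<and> snd i \<in> f}) \<le> 16 * d2"
    if e: "e \<in> E" "e' \<in> E" for e e' X
  proof (rule card_le_mult_cover[OF _ _ _ order.refl])
    have fin: "finite (e \<times> e')" using fine e by simp
    then show "finite {i \<in> e \<times> e'. fst i \<noteq> snd i}" by (rule rev_finite_subset) blast
    have "card {i \<in> e \<times> e'. fst i \<noteq> snd i} \<le> card (e \<times> e')" using fin by (rule card_mono) blast
    then show "card {i \<in> e \<times> e'. fst i \<noteq> snd i} \<le> 16" using E4 e by (simp add: card_cartesian_product)
    fix i assume "i \<in> {i \<in> e \<times> e'. fst i \<noteq> snd i}"
    then have "card {f \<in> E. fst i \<in> f \<and> snd i \<in> f} \<le> d2" by (intro deg2) simp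
    then show "finite ((\<union>) X ` {f \<in> E. fst i \<in> f \<and> snd i \<in> f}) \<and>
        card ((\<union>) X ` {f \<in> E. fst i \<in> f \<and> snd i \<in> f}) \<le> d2"
      using finE card_image_le[of "{f \<in> E. fst i \<in> f \<and> snd i \<in> f}" "(\<union>) X"] by simp
  qed
  have link3: "finite (\<Union>i\<in>{(x, y, z) \<in> e \<times> e \<times> e. distinct [x, y, z]}.
        (\<union>) e ` {f \<in> E. fst i \<in> f \<and> fst (snd i) \<in> f \<and> snd (snd i) \<in> f}) \<and>
      card (\<Union>i\<in>{(x, y, z) \<in> e \<times> e \<times> e. distinct [x, y, z]}.
        (\<union>) e ` {f \<in> E. fst i \<in> f \<and> fst (snd i) \<in> f \<and> snd (snd i) \<in> f}) \<le> 64 * d3"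
    if e: "e \<in> E" for e
  proof (rule card_le_mult_cover[OF _ _ _ order.refl])
    let ?P = "{(x, y, z) \<in> e \<times> e \<times> e. distinct [x, y, z]}"
    have fin: "finite (e \<times> e \<times> e)" using fine e by simp
    then show "finite ?P" by (rule rev_finite_subset) blast
    have "card ?P \<le> card (e \<times> e \<times> e)" using fin by (rule card_mono) blast
    then show "card ?P \<le> 64" using E4 e by (simp add: card_cartesian_product)
    fix i assume "i \<in> ?P"
    then have "distinct [fst i, fst (snd i), snd (snd i)]" by (simp add: case_prod_unfold)
    then have "card {f \<in> E. fst i \<in> f \<and> fst (snd i) \<in> f \<and> snd (snd i) \<in> f} \<le> d3" by (rule deg3)
    then show "finite ((\<union>) e ` {f \<in> E. fst i \<in> f \<and> fst (snd i) \<in> f \<and> snd (snd i) \<in> f}) \<and>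
        card ((\<union>) e ` {f \<in> E. fst i \<in> f \<and> fst (snd i) \<in> f \<and> snd (snd i) \<in> f}) \<le> d3"
      using finE card_image_le[of "{f \<in> E. fst i \<in> f \<and> fst (snd i) \<in> f \<and> snd (snd i) \<in> f}" "(\<union>) e"] by simp
  qed
  have cardB2: "card B2 \<le> card V * d1 * (16 * d2)"
  proof (rule card_le_mult_cover[OF finE cardE link2, THEN conjunct2])
    show "B2 \<subseteq> (\<Union>e\<in>E. \<Union>i\<in>{i \<in> e \<times> e. fst i \<noteq> snd i}. (\<union>) e ` {f \<in> E. fst i \<in> f \<and> snd i \<in> f})"
    proof
      fix X assume "X \<in> B2"
      then obtain e f where ef: "X = e \<union> f" "e \<in> E" "f \<in> E" "card (e \<inter> f) = 2" by (auto simp: B2_def)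
      then obtain x y where xy: "e \<inter> f = {x, y}" "x \<noteq> y" by (auto simp: card_2_iff)
      then have "x \<in> e" "y \<in> e" "x \<in> f" "y \<in> f" by blast+
      then show "X \<in> (\<Union>e\<in>E. \<Union>i\<in>{i \<in> e \<times> e. fst i \<noteq> snd i}. (\<union>) e ` {f \<in> E. fst i \<in> f \<and> snd i \<in> f})"
        using ef xy(2) by (intro UN_I[of e] UN_I[of "(x, y)"] image_eqI[of _ _ f]) simp_all
    qed
  qed
  have cardB3: "card B3 \<le> card V * d1 * (64 * d3)"
  proof (rule card_le_mult_cover[OF finE cardE link3, THEN conjunct2])
    show "B3 \<subseteq> (\<Union>e\<in>E. \<Union>i\<in>{(x, y, z) \<in> e \<times> e \<times> e. distinct [x, y, z]}.
        (\<union>) e ` {f \<in> E. fst i \<in> f \<and> fst (snd i) \<in> f \<and> snd (snd i) \<in> f})"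
    proof
      fix X assume "X \<in> B3"
      then obtain e f where ef: "X = e \<union> f" "e \<in> E" "f \<in> E" "card (e \<inter> f) = 3" by (auto simp: B3_def)
      obtain x y z where xyz: "e \<inter> f = {x, y, z}" "x \<noteq> y" "y \<noteq> z" "x \<noteq> z"
        using ef(4) unfolding card_3_iff by metis
      then have "x \<in> e" "y \<in> e" "z \<in> e" "x \<in> f" "y \<in> f" "z \<in> f" by blast+
      then show "X \<in> (\<Union>e\<in>E. \<Union>i\<in>{(x, y, z) \<in> e \<times> e \<times> e. distinct [x, y, z]}.
        (\<union>) e ` {f \<in> E. fst i \<in> f \<and> fst (snd i) \<in> f \<and> snd (snd i) \<in> f})"
        using ef xyz(2-) by (intro UN_I[of e] UN_I[of "(x, y, z)"] image_eqI[of _ _ f]) simp_all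
    qed
  qed
  \<comment> \<open>Choose the common vertex \<open>v\<close>, two edges at \<open>v\<close>, and a
    third edge through a point of each.\<close>
  have cardB4: "card B4 \<le> card V * (d1 * (d1 * (16 * d2)))"
  proof (rule card_le_mult_cover[OF V order.refl, THEN conjunct2])
    define T where "T e e' = (\<Union>i\<in>{i \<in> e \<times> e'. fst i \<noteq> snd i}. (\<union>) (e \<union> e') ` {f \<in> E. fst i \<in> f \<and> snd i \<in> f})"
      for e e'
    have T: "finite (T e e') \<and> card (T e e') \<le> 16 * d2" if "e \<in> E" "e' \<in> E" for e e'
      unfolding T_def by (rule link2[OF that])
    have T': "finite (\<Union>e'\<in>{e \<in> E. v \<in> e}. T e e') \<and> card (\<Union>e'\<in>{e \<in> E. v \<in> e}. T e e') \<le> d1 * (16 * d2)"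
      if "v \<in> V" "e \<in> E" for v e
      by (rule card_le_mult_cover[OF _ deg1[OF that(1)] _ order.refl]) (use finE T that in simp_all)
    show "finite (\<Union>e\<in>{e \<in> E. v \<in> e}. \<Union>e'\<in>{e \<in> E. v \<in> e}. T e e') \<and>
        card (\<Union>e\<in>{e \<in> E. v \<in> e}. \<Union>e'\<in>{e \<in> E. v \<in> e}. T e e') \<le> d1 * (d1 * (16 * d2))"
      if "v \<in> V" for v
      by (rule card_le_mult_cover[OF _ deg1[OF that] _ order.refl]) (use finE T' that in simp_all)
    show "B4 \<subseteq> (\<Union>v\<in>V. \<Union>e\<in>{e \<in> E. v \<in> e}. \<Union>e'\<in>{e \<in> E. v \<in> e}. T e e')"
    proof
      fix X assume "X \<in> B4"
      then obtain e e' f v where X: "X = e \<union> e' \<union> f" "e \<in> E" "e' \<in> E" "f \<in> E" "v \<in> e" "v \<in> e'" "v \<notin> f"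
        "f \<inter> e \<noteq> {}" "f \<inter> e' \<noteq> {}" "card (e \<inter> e') \<le> 1"
        unfolding B4_def by blast
      obtain x y where xy: "x \<in> f" "x \<in> e" "y \<in> f" "y \<in> e'" using X(8,9) by blast
      have "x \<noteq> y"
      proof
        assume "x = y"
        then have "{v, x} \<subseteq> e \<inter> e'" using xy X(5,6) by simp
        then have "card {v, x} \<le> 1"
          using X(10) card_mono[of "e \<inter> e'" "{v, x}"] fine[OF X(2)] by simp
        moreover have "v \<noteq> x" using xy X(7) by metis
        ultimately show False by simp
      qed
      then have "X \<in> T e e'"
        unfolding T_def using X(1,4) xy by (intro UN_I[of "(x, y)"] image_eqI[of _ _ f]) simp_all
      moreover have "v \<in> V" using X(2,5) E by blast
      ultimately show "X \<in> (\<Union>v\<in>V. \<Union>e\<in>{e \<in> E. v \<in> e}. \<Union>e'\<in>{e \<in> E. v \<in> e}. T e e')"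
        using X(2,3,5,6) by (intro UN_I[of v] UN_I[of e] UN_I[of e']) simp_all
    qed
  qed
  have B2size: "card X = 6" if "X \<in> B2" for X
    using that card_Un_Int[OF fine fine] E4 by (force simp: B2_def)
  have B3size: "card X = 5" if "X \<in> B3" for X
    using that card_Un_Int[OF fine fine] E4 by (force simp: B3_def)
  have B4size: "9 \<le> card X" if "X \<in> B4" for X
  proof -
    obtain e e' f where X: "X = e \<union> e' \<union> f" "e \<in> E" "e' \<in> E" "f \<in> E"
      "card (e \<inter> e') \<le> 1" "card (f \<inter> e) \<le> 1" "card (f \<inter> e') \<le> 1"
      using \<open>X \<in> B4\<close> unfolding B4_def by blast
    have fins: "finite e" "finite e'" "finite f" using X fine by auto
    have "card (e \<union> e') + card (e \<inter> e') = 8"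
      using card_Un_Int[OF fins(1,2)] E4 X by simp
    moreover have "card X + card ((e \<union> e') \<inter> f) = card (e \<union> e') + 4"
      using card_Un_Int[of "e \<union> e'" f] fins E4 X by simp
    moreover have "(e \<union> e') \<inter> f = (f \<inter> e) \<union> (f \<inter> e')" by blast
    then have "card ((e \<union> e') \<inter> f) \<le> card (f \<inter> e) + card (f \<inter> e')"
      using card_Un_le[of "f \<inter> e" "f \<inter> e'"] by simp
    ultimately show ?thesis using X by linarith
  qed
  have "{} \<notin> B2 \<union> B3 \<union> B4" using B2size B3size B4size by fastforce
  from deletion_method[OF V E subV this p a] obtain U where U: "U \<subseteq> V" "\<forall>X\<in>B2 \<union> B3 \<union> B4. \<not> X \<subseteq> U"
    "p * card V - a * (\<Sum>e\<in>E. p ^ card e) - (\<Sum>X\<in>B2 \<union> B3 \<union> B4. p ^ card X) \<le> card U - a * card {e \<in> E. e \<subseteq> U}"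
    by blast
  have lin: "card (e \<inter> f) \<le> 1" if "e \<in> E" "f \<in> E" "e \<subseteq> U" "f \<subseteq> U" "e \<noteq> f" for e f
  proof -
    have "e \<union> f \<notin> B2" "e \<union> f \<notin> B3" using U(2) that by blast+
    then have "card (e \<inter> f) \<noteq> 2" "card (e \<inter> f) \<noteq> 3"
      using that unfolding B2_def B3_def by blast+
    moreover have "card (e \<inter> f) < 4"
    proof (rule ccontr)
      assume "\<not> card (e \<inter> f) < 4"
      then have "e \<inter> f = e" "e \<inter> f = f"
        using card_seteq[of e "e \<inter> f"] card_seteq[of f "e \<inter> f"] fine E4 that by auto
      then show False using that by auto
    qed
    ultimately show ?thesis by linarith
  qed
  have sparse: "sparse_hypergraph U {e \<in> E. e \<subseteq> U}"
  proof
    show "finite U" using U V finite_subset by blast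
    fix e e' f v assume *: "e \<in> {e \<in> E. e \<subseteq> U}" "e' \<in> {e \<in> E. e \<subseteq> U}" "f \<in> {e \<in> E. e \<subseteq> U}"
      "e \<noteq> e'" "v \<in> e" "v \<in> e'" "v \<notin> f"
    have mem: "e \<in> E" "e' \<in> E" "f \<in> E" "e \<subseteq> U" "e' \<subseteq> U" "f \<subseteq> U" "f \<noteq> e" "f \<noteq> e'"
      using * by auto
    have small: "card (e \<inter> e') \<le> 1" "card (f \<inter> e) \<le> 1" "card (f \<inter> e') \<le> 1"
      using lin[OF mem(1,2,4,5) *(4)] lin[OF mem(3,1,6,4,7)] lin[OF mem(3,2,6,5,8)] .
    show "f \<inter> e = {} \<or> f \<inter> e' = {}"
    proof (rule ccontr)
      assume "\<not> (f \<inter> e = {} \<or> f \<inter> e' = {})"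
      then have "f \<inter> e \<noteq> {}" "f \<inter> e' \<noteq> {}" by simp_all
      then have "e \<union> e' \<union> f \<in> B4"
        unfolding B4_def mem_Collect_eq using mem *(5-7) small
        by (intro exI[of _ e] exI[of _ e'] exI[of _ f] exI[of _ v]) simp
      then have "\<not> e \<union> e' \<union> f \<subseteq> U" by (rule bspec[OF U(2) UnI2])
      then show False using mem by simp
    qed
  qed (use E4 lin in auto)
  have bound: "card V * (p - a * real d1 * p ^ 4 - 16 * real d1 * real d2 * p ^ 6
      - 64 * real d1 * real d3 * p ^ 5 - 16 * (real d1)\<^sup>2 * real d2 * p ^ 9)
      \<le> p * card V - a * (\<Sum>e\<in>E. p ^ card e) - (\<Sum>X\<in>B2 \<union> B3 \<union> B4. p ^ card X)"
  proof -
    have union_le: "(\<Sum>X\<in>A \<union> B. p ^ card X) \<le> (\<Sum>X\<in>A. p ^ card X) + (\<Sum>X\<in>B. p ^ card X)"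
      if "finite A" "finite B" for A B :: "'a set set"
      using sum.union_inter[OF that, of "\<lambda>X. p ^ card X"] sum_nonneg[of "A \<inter> B" "\<lambda>X. p ^ card X"] p(1)
      by simp
    have "(\<Sum>e\<in>E. p ^ card e) = card E * p ^ 4" using E4 by simp
    also have "\<dots> \<le> real (card V * d1) * p ^ 4"
      using cardE p by (intro mult_right_mono of_nat_mono) auto
    finally have 1: "a * (\<Sum>e\<in>E. p ^ card e) \<le> a * (real (card V * d1) * p ^ 4)"
      using a by (intro mult_left_mono)
    have "(\<Sum>X\<in>B2. p ^ card X) \<le> real (card V * d1 * (16 * d2)) * p ^ 6"
      using cardB2 B2size p by (simp del: of_nat_mult add: mult_right_mono)
    moreover have "(\<Sum>X\<in>B3. p ^ card X) \<le> real (card V * d1 * (64 * d3)) * p ^ 5"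
      using cardB3 B3size p by (simp del: of_nat_mult add: mult_right_mono)
    moreover have "(\<Sum>X\<in>B4. p ^ card X) \<le> real (card V * (d1 * (d1 * (16 * d2)))) * p ^ 9"
    proof -
      have "(\<Sum>X\<in>B4. p ^ card X) \<le> (\<Sum>X\<in>B4. p ^ 9)"
        using B4size p by (intro sum_mono power_decreasing) auto
      also have "\<dots> \<le> real (card V * (d1 * (d1 * (16 * d2)))) * p ^ 9"
        using cardB4 p by (simp del: of_nat_mult add: mult_right_mono)
      finally show ?thesis .
    qed
    moreover have "(\<Sum>X\<in>B2 \<union> B3 \<union> B4. p ^ card X) \<le>
        (\<Sum>X\<in>B2. p ^ card X) + (\<Sum>X\<in>B3. p ^ card X) + (\<Sum>X\<in>B4. p ^ card X)"
      using union_le[of "B2 \<union> B3" B4] union_le[of B2 B3] fin by simp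
    ultimately show ?thesis using 1 by (simp add: algebra_simps power2_eq_square)
  qed
  show ?thesis
    by (intro exI[of _ U] conjI U(1) sparse order.trans[OF bound U(3)])
qed

section \<open>Counting rhombi in the grid\<close>

definition nsq :: "int \<times> int \<Rightarrow> int" where
  "nsq u = (fst u)\<^sup>2 + (snd u)\<^sup>2"

text \<open>Dividing \<open>a\<close> and \<open>c\<close> by their gcd \<open>g\<close> gives
  coprime \<open>p\<close>, \<open>q\<close> with \<open>p * b = q * d\<close>; a Bezout combination
  of \<open>b\<close> and \<open>d\<close> is then the common factor \<open>h\<close>.\<close>

lemma product_equation_param:
  fixes a b c d :: int
  assumes "a * b = c * d" and "(a, c) \<noteq> (0, 0)"
  obtains p q g h where "a = p * g" "b = q * h" "c = q * g" "d = p * h" "(p, q) \<noteq> (0, 0)"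
proof -
  define g where "g = gcd a c"
  have g: "g \<noteq> 0" using assms(2) by (auto simp: g_def)
  then obtain p q where pq: "a = p * g" "c = q * g" "coprime p q"
    using gcd_coprime_exists[of a c] unfolding g_def by blast
  obtain s r where bez: "s * p + r * q = 1"
    using bezout_int[of p q] pq(3) by auto
  have eq: "p * b = q * d"
    using assms(1) g pq by simp
  define h where "h = r * b + s * d"
  have "q * h = b * (s * p + r * q)"
    using eq by (simp add: h_def algebra_simps)
  moreover have "p * h = d * (s * p + r * q)"
    using eq by (simp add: h_def algebra_simps)
  moreover have "(p, q) \<noteq> (0, 0)" using bez by auto
  ultimately show thesis using that[of p g q h] pq bez by simp
qed

text \<open>Sort the parametrized solutions by \<open>k\<close>, the larger of |p| and |q|: there
  are at most \<open>12 * k\<close> pairs \<open>(p, q)\<close> and at most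
  \<open>9 * (m / k)^2\<close> pairs \<open>(g, h)\<close>. The terms \<open>108 * m^2 / k\<close>
  form a harmonic sum, and the solutions with \<open>a = c = 0\<close> add at most
  \<open>9 * m^2\<close>.\<close>

lemma card_product_equation:
  fixes m :: nat
  assumes m: "1 \<le> m"
  shows "real (card {(a, b, c, d). a * b = c * d \<and> \<bar>a\<bar> \<le> int m \<and> \<bar>b\<bar> \<le> int m \<and> \<bar>c\<bar> \<le> int m \<and> \<bar>d\<bar> \<le> int m})
    \<le> 117 * (real m)\<^sup>2 * (1 + ln (real m))" (is "real (card ?T) \<le> _")
proof -
  define f :: "(int \<times> int) \<times> int \<times> int \<Rightarrow> int \<times> int \<times> int \<times> int"
    where "f = (\<lambda>((p, q), g, h). (p * g, q * h, q * g, p * h))"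
  \<comment> \<open>\<open>Sq k\<close> is the boundary of the square of radius \<open>k\<close> in
    the maximum norm, where \<open>(p, q)\<close> lies; \<open>B k\<close> is the box for
    \<open>(g, h)\<close>.\<close>
  define Sq :: "nat \<Rightarrow> (int \<times> int) set"
    where "Sq k = {int k, - int k} \<times> {- int k..int k} \<union> {- int k..int k} \<times> {int k, - int k}" for k
  define B :: "nat \<Rightarrow> (int \<times> int) set"
    where "B k = {- int (m div k)..int (m div k)} \<times> {- int (m div k)..int (m div k)}" for k
  define Z0 :: "(int \<times> int \<times> int \<times> int) set"
    where "Z0 = (\<lambda>(b, d). (0, b, 0, d)) ` ({- int m..int m} \<times> {- int m..int m})"
  have sub: "?T \<subseteq> Z0 \<union> (\<Union>k\<in>{1..m}. f ` (Sq k \<times> B k))"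
  proof
    fix x assume "x \<in> ?T"
    then obtain a b c d where x: "x = (a, b, c, d)" and eq: "a * b = c * d"
      and le: "\<bar>a\<bar> \<le> int m" "\<bar>b\<bar> \<le> int m" "\<bar>c\<bar> \<le> int m" "\<bar>d\<bar> \<le> int m" by auto
    show "x \<in> Z0 \<union> (\<Union>k\<in>{1..m}. f ` (Sq k \<times> B k))"
    proof (cases "(a, c) = (0, 0)")
      case True
      then have "x \<in> Z0" 
        using le unfolding x Z0_def by (intro image_eqI[of _ _ "(b, d)"]) auto
      then show ?thesis ..
    next
      case False
      then obtain p q g h where par: "a = p * g" "b = q * h" "c = q * g" "d = p * h" "(p, q) \<noteq> (0, 0)"
        using product_equation_param[OF eq] by metis
      have g: "g \<noteq> 0" using False par by auto
      define k where "k = nat (max \<bar>p\<bar> \<bar>q\<bar>)"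
      have k: "int k = max \<bar>p\<bar> \<bar>q\<bar>" "1 \<le> k" using par(5) by (auto simp: k_def)
      have bound: "\<bar>z\<bar> \<le> int (m div k)" if "\<bar>p * z\<bar> \<le> int m" "\<bar>q * z\<bar> \<le> int m" for z
      proof -
        have "int k * \<bar>z\<bar> \<le> int m"
          using that unfolding k(1) abs_mult by (auto simp: max_def)
        then have "k * nat \<bar>z\<bar> \<le> m"
          by (metis nat_int nat_mult_distrib of_nat_0_le_iff nat_mono)
        then have "nat \<bar>z\<bar> \<le> m div k"
          using k(2) by (simp add: less_eq_div_iff_mult_less_eq mult.commute)
        then show ?thesis by linarith
      qed
      have gh: "\<bar>g\<bar> \<le> int (m div k)" "\<bar>h\<bar> \<le> int (m div k)"
        using le par by (auto intro!: bound)
      \<comment> \<open>A nonzero \<open>g\<close> in the box forces \<open>k \<le> m\<close>, which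
        bounds the range of the sum.\<close>
      have "1 \<le> m div k"
        using g gh(1) by linarith
      then have "k \<le> m" using k(2) by (simp add: less_eq_div_iff_mult_less_eq)
      moreover have "(p, q) \<in> Sq k"
        using k(1) by (auto simp: Sq_def max_def split: if_splits)
      moreover have "(g, h) \<in> B k" using gh by (auto simp: B_def)
      moreover have "x = f ((p, q), g, h)" by (simp add: x f_def par)
      ultimately show ?thesis using k(2) by (intro UnI2 UN_I[of k] image_eqI[of _ _ "((p, q), g, h)"]) auto
    qed
  qed
  have finS: "finite (Sq k)" "finite (B k)" for k by (auto simp: Sq_def B_def)
  have symint: "card {- int j..int j} = 2 * j + 1" for j by simp
  have cardSq: "card (Sq k) \<le> 12 * k" if "1 \<le> k" for k
  proof -
    have "card (Sq k) \<le> card ({int k, - int k} \<times> {- int k..int k}) + card ({- int k..int k} \<times> {int k, - int k})"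
      unfolding Sq_def by (rule card_Un_le)
    also have "\<dots> \<le> 2 * (2 * (2 * k + 1))"
      by (simp add: card_cartesian_product card_insert_if symint del: card_atLeastAtMost_int)
    also have "\<dots> \<le> 12 * k" using that by simp
    finally show ?thesis .
  qed
  have cardB: "card (B k) = (2 * (m div k) + 1)\<^sup>2" for k
    by (simp add: B_def card_cartesian_product power2_eq_square symint del: card_atLeastAtMost_int)
  have "card Z0 \<le> card ({- int m..int m} \<times> {- int m..int m})"
    unfolding Z0_def by (rule card_image_le) simp
  also have "\<dots> = (2 * m + 1)\<^sup>2"
    by (simp add: card_cartesian_product power2_eq_square symint del: card_atLeastAtMost_int)
  also have "\<dots> \<le> (3 * m)\<^sup>2" using m by (intro power_mono) auto
  finally have cardZ0: "card Z0 \<le> 9 * m\<^sup>2" by (simp add: power_mult_distrib)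
  have "card ?T \<le> card (Z0 \<union> (\<Union>k\<in>{1..m}. f ` (Sq k \<times> B k)))"
    using finS by (intro card_mono sub) (auto simp: Z0_def)
  also have "\<dots> \<le> card Z0 + card (\<Union>k\<in>{1..m}. f ` (Sq k \<times> B k))"
    by (rule card_Un_le)
  also have "card (\<Union>k\<in>{1..m}. f ` (Sq k \<times> B k)) \<le> (\<Sum>k\<in>{1..m}. card (f ` (Sq k \<times> B k)))"
    by (rule card_UN_le) simp
  also have "\<dots> \<le> (\<Sum>k\<in>{1..m}. 12 * k * (2 * (m div k) + 1)\<^sup>2)"
  proof (rule sum_mono)
    fix k assume k: "k \<in> {1..m}"
    have "card (f ` (Sq k \<times> B k)) \<le> card (Sq k \<times> B k)"
      using finS by (intro card_image_le) auto
    also have "\<dots> \<le> 12 * k * (2 * (m div k) + 1)\<^sup>2"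
      unfolding card_cartesian_product cardB using cardSq k by (intro mult_right_mono) auto
    finally show "card (f ` (Sq k \<times> B k)) \<le> 12 * k * (2 * (m div k) + 1)\<^sup>2" .
  qed
  finally have "real (card ?T) \<le> real (9 * m\<^sup>2 + (\<Sum>k\<in>{1..m}. 12 * k * (2 * (m div k) + 1)\<^sup>2))"
    using cardZ0 by (intro of_nat_mono) linarith
  also have "\<dots> \<le> 9 * (real m)\<^sup>2 + (\<Sum>k\<in>{1..m}. 108 * (real m)\<^sup>2 * inverse (real k))"
  proof -
    have "real (12 * k * (2 * (m div k) + 1)\<^sup>2) \<le> 108 * (real m)\<^sup>2 * inverse (real k)"
      if k: "k \<in> {1..m}" for k
    proof -
      have "1 \<le> m div k" using k by (simp add: less_eq_div_iff_mult_less_eq)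
      then have "real (2 * (m div k) + 1) \<le> 3 * real (m div k)" by simp
      also have "\<dots> \<le> 3 * (real m / real k)"
        using of_nat_div_le_of_nat[of m k, where ?'a = real] by simp
      finally have "real (12 * k) * (real (2 * (m div k) + 1))\<^sup>2 \<le> real (12 * k) * (3 * (real m / real k))\<^sup>2"
        by (intro mult_left_mono power_mono) auto
      also have "\<dots> = 108 * (real m)\<^sup>2 * inverse (real k)"
        using k by (simp add: field_simps power2_eq_square)
      finally show ?thesis by simp
    qed
    then have "(\<Sum>k\<in>{1..m}. real (12 * k * (2 * (m div k) + 1)\<^sup>2)) \<le> (\<Sum>k\<in>{1..m}. 108 * (real m)\<^sup>2 * inverse (real k))"
      by (rule sum_mono)
    then show ?thesis by simp
  qed
  also have "\<dots> = 9 * (real m)\<^sup>2 + 108 * (real m)\<^sup>2 * harm m"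
    by (simp add: harm_def sum_distrib_left)
  \<comment> \<open>\<open>harm m - ln m\<close> is decreasing in \<open>m\<close> and equals 1 at
    \<open>m = 1\<close>.\<close>
  also have "\<dots> \<le> 9 * (real m)\<^sup>2 + 108 * (real m)\<^sup>2 * (1 + ln (real m))"
    using euler_mascheroni_sequence_decreasing[of 1 m] m
    by (intro add_left_mono mult_left_mono) (auto simp: harm_expand)
  also have "9 * (real m)\<^sup>2 + 108 * (real m)\<^sup>2 * (1 + ln (real m)) \<le> 117 * (real m)\<^sup>2 * (1 + ln (real m))"
    using m by (simp add: algebra_simps mult_left_mono)
  finally show ?thesis by simp
qed

text \<open>Equal norms \<open>x^2 + y^2 = z^2 + w^2\<close> mean
  \<open>(x - z) * (x + z) = (w - y) * (w + y)\<close>, a product equation with entries up to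
  \<open>2 * n\<close>.\<close>

lemma card_equal_nsq_pairs:
  fixes n :: nat
  assumes n: "1 \<le> n"
  defines "D \<equiv> {- int n..int n} \<times> {- int n..int n}"
  shows "real (card {(u, v). u \<in> D \<and> v \<in> D \<and> nsq u = nsq v}) \<le> 1000 * (real n)\<^sup>2 * (1 + ln (real n))"
    (is "real (card ?P) \<le> _")
proof -
  let ?T = "{(a, b, c, d). a * b = c * d \<and> \<bar>a\<bar> \<le> int (2 * n) \<and> \<bar>b\<bar> \<le> int (2 * n) \<and> \<bar>c\<bar> \<le> int (2 * n) \<and> \<bar>d\<bar> \<le> int (2 * n)}"
  define f :: "(int \<times> int) \<times> (int \<times> int) \<Rightarrow> int \<times> int \<times> int \<times> int"
    where "f = (\<lambda>((x, y), (z, w)). (x - z, x + z, w - y, w + y))"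
  have "inj_on f ?P"
  proof (rule inj_onI)
    fix p q assume "f p = f q"
    moreover obtain x y z w x' y' z' w' where pq: "p = ((x, y), (z, w))" "q = ((x', y'), (z', w'))"
      by (metis surj_pair)
    ultimately have "x - z = x' - z'" "x + z = x' + z'" "w - y = w' - y'" "w + y = w' + y'"
      by (simp_all add: f_def)
    then have "x = x'" "z = z'" "w = w'" "y = y'" by linarith+
    then show "p = q" by (simp add: pq)
  qed
  moreover have "f ` ?P \<subseteq> ?T"
  proof
    fix r assume "r \<in> f ` ?P"
    then obtain p where p: "p \<in> ?P" "r = f p" by blast
    obtain x y z w where pq: "p = ((x, y), (z, w))" by (metis surj_pair)
    have r: "r = f ((x, y), (z, w))"
      and mem: "(x, y) \<in> D" "(z, w) \<in> D" and eq: "nsq (x, y) = nsq (z, w)"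
      using p unfolding pq by simp_all
    have "\<bar>x\<bar> \<le> int n" "\<bar>y\<bar> \<le> int n" "\<bar>z\<bar> \<le> int n" "\<bar>w\<bar> \<le> int n"
      using mem by (auto simp: D_def)
    then have "\<bar>x - z\<bar> \<le> int (2 * n)" "\<bar>x + z\<bar> \<le> int (2 * n)"
      "\<bar>w - y\<bar> \<le> int (2 * n)" "\<bar>w + y\<bar> \<le> int (2 * n)" by linarith+
    moreover have "(x - z) * (x + z) = (w - y) * (w + y)"
      using eq by (simp add: nsq_def power2_eq_square algebra_simps)
    ultimately show "r \<in> ?T" by (simp add: r f_def)
  qed
  moreover have "finite ?T"
  proof (rule finite_subset)
    let ?B = "{- int (2 * n)..int (2 * n)}"
    show "?T \<subseteq> ?B \<times> ?B \<times> ?B \<times> ?B"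
    proof
      fix r assume r: "r \<in> ?T"
      obtain a b c d where abcd: "r = (a, b, c, d)" by (metis surj_pair)
      have "\<bar>a\<bar> \<le> int (2 * n)" "\<bar>b\<bar> \<le> int (2 * n)" "\<bar>c\<bar> \<le> int (2 * n)" "\<bar>d\<bar> \<le> int (2 * n)"
        using r unfolding abcd by simp_all
      then have "a \<in> ?B" "b \<in> ?B" "c \<in> ?B" "d \<in> ?B" by (simp_all only: atLeastAtMost_iff) linarith+
      then show "r \<in> ?B \<times> ?B \<times> ?B \<times> ?B" unfolding abcd by blast
    qed
  qed simp
  ultimately have "card ?P \<le> card ?T" using card_inj_on_le by blast
  then have "real (card ?P) \<le> real (card ?T)" by simp
  also have "\<dots> \<le> 117 * (real (2 * n))\<^sup>2 * (1 + ln (real (2 * n)))"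
    using n by (intro card_product_equation) simp
  also have "\<dots> = 468 * (real n)\<^sup>2 * (1 + ln 2 + ln (real n))"
    using n by (simp add: ln_mult power_mult_distrib)
  also have "\<dots> \<le> 468 * (real n)\<^sup>2 * (2 * (1 + ln (real n)))"
  proof (intro mult_left_mono)
    have "ln 2 \<le> (1::real)" using ln_2_less_1 by simp
    moreover have "0 \<le> ln (real n)" using n by simp
    ultimately show "1 + ln 2 + ln (real n) \<le> 2 * (1 + ln (real n))" by argo
  qed simp
  also have "\<dots> \<le> 1000 * (real n)\<^sup>2 * (1 + ln (real n))"
    using n by (simp add: mult_right_mono)
  finally show ?thesis .
qed

section \<open>Rhombi in the integer grid and their degrees\<close>

definition int_grid :: "nat \<Rightarrow> (int \<times> int) set" where
  "int_grid n = {1..int n} \<times> {1..int n}"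

definition parallelogram :: "int \<times> int \<Rightarrow> int \<times> int \<Rightarrow> int \<times> int \<Rightarrow> (int \<times> int) set" where
  "parallelogram a u v = {a, a + u, a + v, a + u + v}"

text \<open>A rhombus is its vertex set, so all its labellings give one edge. For sides of equal
  length the only degenerate cases are zero sides, \<open>v = u\<close> and
  \<open>v = - u\<close>.\<close>

definition rhombi :: "nat \<Rightarrow> (int \<times> int) set set" where
  "rhombi n = {parallelogram a u v | a u v. nsq u = nsq v \<and> u \<noteq> 0 \<and> u \<noteq> v \<and> u + v \<noteq> 0 \<and>
     parallelogram a u v \<subseteq> int_grid n}"

lemma finite_int_grid: "finite (int_grid n)"
  by (simp add: int_grid_def)

lemma card_int_grid: "card (int_grid n) = n\<^sup>2"
  by (simp add: int_grid_def card_cartesian_product power2_eq_square)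

lemma nsq_uminus [simp]: "nsq (- u) = nsq u"
  by (simp add: nsq_def)

lemma nsq_minus_commute: "nsq (u - v) = nsq (v - u)"
  by (simp add: nsq_def power2_commute)

lemma nsq_eq_0_iff [simp]: "nsq u = 0 \<longleftrightarrow> u = 0"
  by (cases u) (simp add: nsq_def sum_power2_eq_zero_iff zero_prod_def)

lemma rhombi_subset: "rhombi n \<subseteq> Pow (int_grid n)"
  by (auto simp: rhombi_def)

lemma card_rhombi_elem:
  assumes "e \<in> rhombi n"
  shows "card e = 4"
proof -
  obtain a u v where e: "e = parallelogram a u v" "nsq u = nsq v" "u \<noteq> 0" "u \<noteq> v" "u + v \<noteq> 0"
    using assms unfolding rhombi_def by blast
  have "v \<noteq> 0" using e(2,3) nsq_eq_0_iff by metis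
  moreover have "a \<noteq> a + u + v" using e(5) by (simp add: add.assoc)
  ultimately show ?thesis using e unfolding parallelogram_def by simp
qed

text \<open>Passing to another vertex as base point only reverses sides, which keeps their
  lengths.\<close>

lemma parallelogram_rebase:
  assumes "x \<in> parallelogram a u v"
  shows "\<exists>u' v'. parallelogram a u v = parallelogram x u' v' \<and> (u' = u \<or> u' = - u) \<and> (v' = v \<or> v' = - v)"
proof -
  consider "x = a" | "x = a + u" | "x = a + v" | "x = a + u + v"
    using assms unfolding parallelogram_def by blast
  then show ?thesis
  proof cases
    case 1
    then show ?thesis by blast
  next
    case 2
    then have "parallelogram a u v = parallelogram x (- u) v"
      unfolding parallelogram_def by (auto simp: algebra_simps)
    then show ?thesis by blast
  next
    case 3
    then have "parallelogram a u v = parallelogram x u (- v)"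
      unfolding parallelogram_def by (auto simp: algebra_simps)
    then show ?thesis by blast
  next
    case 4
    then have "parallelogram a u v = parallelogram x (- u) (- v)"
      unfolding parallelogram_def by (auto simp: algebra_simps)
    then show ?thesis by blast
  qed
qed

lemma rhombi_based:
  assumes "e \<in> rhombi n" "x \<in> e"
  obtains u v where "e = parallelogram x u v" "nsq u = nsq v" "e \<subseteq> int_grid n"
proof -
  obtain a u v where e: "e = parallelogram a u v" "nsq u = nsq v" "e \<subseteq> int_grid n"
    using assms(1) unfolding rhombi_def by blast
  then obtain u' v' where "e = parallelogram x u' v'" "u' = u \<or> u' = - u" "v' = v \<or> v' = - v"
    using parallelogram_rebase assms(2) by metis
  then show thesis using that e by (metis nsq_uminus)
qed

text \<open>A rhombus at \<open>x\<close> is determined by its two side vectors there, which are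
  grid differences of equal length.\<close>

lemma card_rhombi_at_point:
  assumes n: "1 \<le> n"
  shows "real (card {e \<in> rhombi n. x \<in> e}) \<le> 1000 * (real n)\<^sup>2 * (1 + ln (real n))"
proof -
  define D where "D = {- int n..int n} \<times> {- int n..int n}"
  let ?P = "{(u, v). u \<in> D \<and> v \<in> D \<and> nsq u = nsq v}"
  have finD: "finite (D \<times> D)" by (simp add: D_def)
  then have finP: "finite ?P" by (rule rev_finite_subset) blast
  have "{e \<in> rhombi n. x \<in> e} \<subseteq> (\<lambda>(u, v). parallelogram x u v) ` ?P"
  proof
    fix e assume "e \<in> {e \<in> rhombi n. x \<in> e}"
    then obtain u v where e: "e = parallelogram x u v" "nsq u = nsq v" "e \<subseteq> int_grid n"
      using rhombi_based by blast
    have "x \<in> int_grid n" "x + u \<in> int_grid n" "x + v \<in> int_grid n"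
      using e(1,3) by (simp_all add: parallelogram_def)
    then have "u \<in> D" "v \<in> D"
      by (simp_all add: int_grid_def D_def mem_Times_iff)
    then show "e \<in> (\<lambda>(u, v). parallelogram x u v) ` ?P"
      using e by (intro image_eqI[of _ _ "(u, v)"]) simp_all
  qed
  then have "card {e \<in> rhombi n. x \<in> e} \<le> card ?P" by (rule surj_card_le[OF finP])
  then show ?thesis
    using card_equal_nsq_pairs[OF n] unfolding D_def by linarith
qed

text \<open>Each of the \<open>n\<close> columns meets the circle in at most two points, mirror
  images at the height of the centre.\<close>

lemma card_circle:
  "card {c \<in> int_grid n. nsq (c - x) = r} \<le> 2 * n"
proof -
  define T where "T i = {c \<in> int_grid n. nsq (c - x) = r \<and> fst c = i}" for i
  have "finite (T i) \<and> card (T i) \<le> 2" for i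
  proof (cases "T i = {}")
    case False
    then obtain c where c: "c \<in> T i" by blast
    have "T i \<subseteq> {c, (i, 2 * snd x - snd c)}"
    proof
      fix d assume d: "d \<in> T i"
      have "nsq (c - x) = nsq (d - x)" "fst c = i" "fst d = i" using c d by (simp_all add: T_def)
      then have "(snd d - snd x)\<^sup>2 = (snd c - snd x)\<^sup>2" by (simp add: nsq_def)
      then have "snd d - snd x = snd c - snd x \<or> snd d - snd x = - (snd c - snd x)"
        by (simp only: power2_eq_iff)
      then have "snd d = snd c \<or> snd d = 2 * snd x - snd c" by auto
      then show "d \<in> {c, (i, 2 * snd x - snd c)}"
        using \<open>fst c = i\<close> \<open>fst d = i\<close> by (auto simp: prod_eq_iff)
    qed
    moreover have "card {c, (i, 2 * snd x - snd c)} \<le> 2" by (simp add: card_insert_if)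
    ultimately show ?thesis
      by (meson card_mono finite.emptyI finite.insertI finite_subset order_trans)
  qed simp
  then have "card {c \<in> int_grid n. nsq (c - x) = r} \<le> n * 2"
    by (intro card_le_mult_cover[of "{1..int n}" n T, THEN conjunct2])
      (auto simp: T_def int_grid_def)
  then show ?thesis by simp
qed

text \<open>The points lie on a line perpendicular to \<open>x - y\<close>. One of the two
  coordinates is injective on it and takes at most \<open>n\<close> values.\<close>

lemma card_bisector:
  assumes "x \<noteq> y"
  shows "card {c \<in> int_grid n. nsq (c - x) = nsq (c - y)} \<le> n"
proof -
  let ?B = "{c \<in> int_grid n. nsq (c - x) = nsq (c - y)}"
  have line: "(fst c - fst d) * (fst x - fst y) + (snd c - snd d) * (snd x - snd y) = 0"
    if "c \<in> ?B" "d \<in> ?B" for c d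
  proof -
    have "nsq (c - x) = nsq (c - y)" "nsq (d - x) = nsq (d - y)" using that by simp_all
    then have "2 * ((fst c - fst d) * (fst x - fst y) + (snd c - snd d) * (snd x - snd y)) = 0"
      by (simp add: nsq_def power2_eq_square algebra_simps)
    then show ?thesis by simp
  qed
  have "inj_on fst ?B \<or> inj_on snd ?B"
  proof (cases "snd x = snd y")
    case True
    then have "fst x \<noteq> fst y" using assms by (simp add: prod_eq_iff)
    have "inj_on snd ?B"
    proof (rule inj_onI)
      fix c d assume cd: "c \<in> ?B" "d \<in> ?B" "snd c = snd d"
      then have "(fst c - fst d) * (fst x - fst y) = 0" using line[OF cd(1,2)] by simp
      then show "c = d" using \<open>fst x \<noteq> fst y\<close> cd(3) by (simp add: prod_eq_iff)
    qed
    then show ?thesis ..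
  next
    case False
    have "inj_on fst ?B"
    proof (rule inj_onI)
      fix c d assume cd: "c \<in> ?B" "d \<in> ?B" "fst c = fst d"
      then have "(snd c - snd d) * (snd x - snd y) = 0" using line[OF cd(1,2)] by simp
      then show "c = d" using False cd(3) by (simp add: prod_eq_iff)
    qed
    then show ?thesis ..
  qed
  then obtain g where "inj_on g ?B" "g ` ?B \<subseteq> {1..int n}"
  proof
    assume "inj_on fst ?B"
    moreover have "fst ` ?B \<subseteq> {1..int n}" by (auto simp: int_grid_def)
    ultimately show thesis by (rule that)
  next
    assume "inj_on snd ?B"
    moreover have "snd ` ?B \<subseteq> {1..int n}" by (auto simp: int_grid_def)
    ultimately show thesis by (rule that)
  qed
  then show ?thesis using card_inj_on_le[of g ?B "{1..int n}"] by simp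
qed

lemma parallelogram_commute: "parallelogram a u v = parallelogram a v u"
  by (auto simp: parallelogram_def add_ac)

text \<open>If \<open>x\<close> and \<open>y\<close> span a side, the other neighbour of
  \<open>x\<close> lies on the circle about \<open>x\<close> through \<open>y\<close>; if they span
  a diagonal, a remaining vertex lies on their bisector. In both cases that vertex fixes the
  rhombus.\<close>

lemma card_rhombi_at_pair:
  assumes "x \<noteq> y"
  shows "card {e \<in> rhombi n. x \<in> e \<and> y \<in> e} \<le> 3 * n"
proof -
  define C where "C = {c \<in> int_grid n. nsq (c - x) = nsq (y - x)}"
  define B where "B = {c \<in> int_grid n. nsq (c - x) = nsq (c - y)}"
  have fin: "finite C" "finite B" using finite_int_grid by (auto simp: C_def B_def)
  have "{e \<in> rhombi n. x \<in> e \<and> y \<in> e} \<subseteq>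
      (\<lambda>c. parallelogram x (y - x) (c - x)) ` C \<union> (\<lambda>c. parallelogram x (c - x) (y - c)) ` B"
  proof
    fix e assume "e \<in> {e \<in> rhombi n. x \<in> e \<and> y \<in> e}"
    then have "e \<in> rhombi n" "x \<in> e" "y \<in> e" by auto
    then obtain u v where e: "e = parallelogram x u v" "nsq u = nsq v" "e \<subseteq> int_grid n"
      using rhombi_based by metis
    have grid: "x + u \<in> int_grid n" "x + v \<in> int_grid n"
      using e(1,3) by (simp_all add: parallelogram_def)
    consider "y = x + u" | "y = x + v" | "y = x + u + v"
      using \<open>y \<in> e\<close> assms unfolding e(1) parallelogram_def by blast
    then show "e \<in> (\<lambda>c. parallelogram x (y - x) (c - x)) ` C \<union> (\<lambda>c. parallelogram x (c - x) (y - c)) ` B"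
    proof cases
      case 1
      then have "e = parallelogram x (y - x) (x + v - x)" "x + v \<in> C"
        using e grid by (simp_all add: C_def)
      then show ?thesis by blast
    next
      case 2
      then have "e = parallelogram x (y - x) (x + u - x)" "x + u \<in> C"
        using e grid by (simp_all add: C_def parallelogram_commute)
      then show ?thesis by blast
    next
      case 3
      then have "x + u - y = - v" by simp
      then have "nsq (x + u - y) = nsq v" by (simp only: nsq_uminus)
      then have "e = parallelogram x (x + u - x) (y - (x + u))" "x + u \<in> B"
        using e grid 3 by (simp_all add: B_def)
      then show ?thesis by blast
    qed
  qed
  then have "card {e \<in> rhombi n. x \<in> e \<and> y \<in> e} \<le>
      card ((\<lambda>c. parallelogram x (y - x) (c - x)) ` C \<union> (\<lambda>c. parallelogram x (c - x) (y - c)) ` B)"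
    using fin by (intro card_mono) auto
  also have "\<dots> \<le> card C + card B"
    using card_Un_le card_image_le fin by (meson add_mono order_trans)
  also have "\<dots> \<le> 3 * n"
    using card_circle[of n x "nsq (y - x)"] card_bisector[OF assms, of n] by (simp add: C_def B_def)
  finally show ?thesis .
qed

text \<open>Three vertices fix a parallelogram once it is known which two of them are
  opposite.\<close>

lemma card_rhombi_at_triple:
  assumes "distinct [x, y, z]"
  shows "card {e \<in> rhombi n. x \<in> e \<and> y \<in> e \<and> z \<in> e} \<le> 3"
proof -
  have "{e \<in> rhombi n. x \<in> e \<and> y \<in> e \<and> z \<in> e} \<subseteq>
      {parallelogram x (y - x) (z - x), parallelogram x (y - x) (z - y), parallelogram x (z - x) (y - z)}"
  proof
    fix e assume "e \<in> {e \<in> rhombi n. x \<in> e \<and> y \<in> e \<and> z \<in> e}"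
    then have *: "e \<in> rhombi n" "x \<in> e" "y \<in> e" "z \<in> e" by auto
    then obtain u v where e: "e = parallelogram x u v"
      using rhombi_based by metis
    have "y = x + u \<or> y = x + v \<or> y = x + u + v" "z = x + u \<or> z = x + v \<or> z = x + u + v" "y \<noteq> z"
      using * assms unfolding e parallelogram_def by auto
    then consider "y = x + u" "z = x + v" | "y = x + v" "z = x + u" | "y = x + u" "z = x + u + v"
      | "y = x + v" "z = x + u + v" | "z = x + u" "y = x + u + v" | "z = x + v" "y = x + u + v"
      by blast
    then show "e \<in> {parallelogram x (y - x) (z - x), parallelogram x (y - x) (z - y), parallelogram x (z - x) (y - z)}"
      unfolding e by cases (simp_all add: parallelogram_commute[of x v u] algebra_simps)
  qed
  then have "card {e \<in> rhombi n. x \<in> e \<and> y \<in> e \<and> z \<in> e} \<le>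
      card {parallelogram x (y - x) (z - x), parallelogram x (y - x) (z - y), parallelogram x (z - x) (y - z)}"
    by (intro card_mono) auto
  also have "\<dots> \<le> 3" by (simp add: card_insert_if)
  finally show ?thesis .
qed

section \<open>From Euclidean rhombi to integer rhombi\<close>

definition embed :: "int \<times> int \<Rightarrow> real \<times> real" where
  "embed = map_prod of_int of_int"

lemma inj_embed: "inj embed"
  unfolding embed_def by (intro prod.inj_map injI) simp_all

lemma embed_int_grid: "embed ` int_grid n = grid n"
proof -
  have "(of_int ` {1..int n} :: real set) = real ` {1..n}"
    by (simp add: image_image flip: image_int_atLeastAtMost[of 1 n, simplified])
  then show ?thesis
    unfolding embed_def int_grid_def grid_def by (metis map_prod_image)
qed

lemma norm_embed_diff: "(norm (embed a - embed b))\<^sup>2 = of_int (nsq (a - b))"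
  by (cases a; cases b) (simp add: embed_def norm_Pair nsq_def)

text \<open>Four equal sides force a parallelogram: they make the diagonals orthogonal to each other
  and \<open>a + c - b - d\<close> orthogonal to both. Nonzero orthogonal diagonals span the plane,
  so this vector vanishes.\<close>

lemma rhombus_embed:
  assumes "rhombus (embed a) (embed b) (embed c) (embed d)" "{a, b, c, d} \<subseteq> int_grid n"
  shows "{a, b, c, d} \<in> rhombi n"
proof -
  have dist: "distinct [a, b, c, d]" using assms(1) by (auto simp: rhombus_def)
  have "(norm (embed a - embed b))\<^sup>2 = (norm (embed b - embed c))\<^sup>2"
    "(norm (embed b - embed c))\<^sup>2 = (norm (embed c - embed d))\<^sup>2"
    "(norm (embed c - embed d))\<^sup>2 = (norm (embed d - embed a))\<^sup>2"
    using assms(1) by (simp_all add: rhombus_def)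
  then have sides: "nsq (a - b) = nsq (b - c)" "nsq (b - c) = nsq (c - d)" "nsq (c - d) = nsq (d - a)"
    unfolding norm_embed_diff by (simp_all only: of_int_eq_iff)
  obtain a1 a2 b1 b2 c1 c2 d1 d2
    where coords: "a = (a1, a2)" "b = (b1, b2)" "c = (c1, c2)" "d = (d1, d2)" by (metis surj_pair)
  define s1 s2 p1 p2 q1 q2
    where defs: "s1 = a1 + c1 - b1 - d1" "s2 = a2 + c2 - b2 - d2"
      "p1 = a1 - c1" "p2 = a2 - c2" "q1 = b1 - d1" "q2 = b2 - d2"
  define \<Delta> where "\<Delta> = p1 * q2 - p2 * q1"
  have orth: "p1 * q1 + p2 * q2 = 0" "s1 * p1 + s2 * p2 = 0" "s1 * q1 + s2 * q2 = 0"
    using sides by (simp_all add: coords nsq_def defs power2_eq_square algebra_simps)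
  \<comment> \<open>Lagrange's identity: nonzero orthogonal diagonals have nonzero
    determinant.\<close>
  have "\<Delta>\<^sup>2 = (p1\<^sup>2 + p2\<^sup>2) * (q1\<^sup>2 + q2\<^sup>2) - (p1 * q1 + p2 * q2)\<^sup>2"
    by (simp add: \<Delta>_def power2_eq_square algebra_simps)
  moreover have "p1\<^sup>2 + p2\<^sup>2 \<noteq> 0" "q1\<^sup>2 + q2\<^sup>2 \<noteq> 0"
    using dist by (auto simp: sum_power2_eq_zero_iff defs coords)
  ultimately have "\<Delta> \<noteq> 0" using orth(1) by auto
  have cramer: "s1 * \<Delta> = q2 * (s1 * p1 + s2 * p2) - p2 * (s1 * q1 + s2 * q2)"
    "s2 * \<Delta> = p1 * (s1 * q1 + s2 * q2) - q1 * (s1 * p1 + s2 * p2)"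
    by (simp_all add: \<Delta>_def algebra_simps)
  have "s1 * \<Delta> = 0" "s2 * \<Delta> = 0" unfolding cramer orth by simp_all
  then have "s1 = 0" "s2 = 0" using \<open>\<Delta> \<noteq> 0\<close> by simp_all
  then have "c = b + d - a" by (simp add: coords defs)
  then have eq: "{a, b, c, d} = parallelogram a (b - a) (d - a)"
    by (auto simp: parallelogram_def algebra_simps)
  have "nsq (b - a) = nsq (d - a)" using sides nsq_minus_commute by metis
  moreover have "b - a \<noteq> 0" "b - a \<noteq> d - a" using dist by auto
  moreover have "b - a + (d - a) \<noteq> 0" using dist \<open>c = b + d - a\<close> by (auto simp: algebra_simps)
  ultimately show ?thesis using assms(2) unfolding rhombi_def eq by blast
qed

section \<open>Large rhombus-free sets\<close>

lemma rhombus_free_image_independent: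
  assumes "I \<subseteq> int_grid n" "\<forall>e\<in>rhombi n. \<not> e \<subseteq> I"
  shows "rhombus_free (embed ` I)"
  unfolding rhombus_free_def
proof
  assume "\<exists>a\<in>embed ` I. \<exists>b\<in>embed ` I. \<exists>c\<in>embed ` I. \<exists>d\<in>embed ` I. rhombus a b c d"
  then obtain a b c d where abcd: "a \<in> I" "b \<in> I" "c \<in> I" "d \<in> I"
    "rhombus (embed a) (embed b) (embed c) (embed d)" by blast
  then have "{a, b, c, d} \<in> rhombi n" using assms(1) by (intro rhombus_embed) auto
  then have "\<not> {a, b, c, d} \<subseteq> I" using assms(2) by blast
  then show False using abcd by simp
qed

text \<open>Deletion with \<open>a = 1 / D\<close>: the edges take \<open>p / 4\<close> and each of
  the three kinds of bad configurations takes \<open>p / 12\<close>, so half of \<open>p\<close>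
  survives. The edges keep weight \<open>1 / D\<close> in this inequality, hence it also bounds
  their density.\<close>

lemma sparse_rhombi:
  fixes n :: nat
  assumes n: "1 \<le> n"
  defines "p \<equiv> real n powr (- 19 / 30)" and "l \<equiv> 1 + ln (real n)"
  assumes bounds: "48000 * real n ^ 3 * l * p ^ 5 \<le> 1 / 12" "192000 * real n ^ 2 * l * p ^ 4 \<le> 1 / 12"
    "48000000 * real n ^ 5 * l\<^sup>2 * p ^ 8 \<le> 1 / 12"
  shows "\<exists>U\<subseteq>int_grid n. sparse_hypergraph U {e \<in> rhombi n. e \<subseteq> U} \<and>
    (real n)\<^sup>2 * p / 2 \<le> card U \<and>
    card {e \<in> rhombi n. e \<subseteq> U} \<le> 4000 * (real n)\<^sup>2 * l * p ^ 3 * card U"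
proof -
  define d1 where "d1 = nat \<lfloor>1000 * (real n)\<^sup>2 * l\<rfloor>"
  define D where "D = 4000 * (real n)\<^sup>2 * l * p ^ 3"
  have l: "1 \<le> l" using n by (simp add: l_def)
  have p: "0 < p" "p \<le> 1"
    using n powr_mono[of "- 19 / 30" 0 "real n"] by (simp_all add: p_def)
  have d1: "real d1 \<le> 1000 * (real n)\<^sup>2 * l"
    using l by (simp add: d1_def)
  have D: "0 < D" using n l p by (simp add: D_def)
  have deg1: "card {e \<in> rhombi n. x \<in> e} \<le> d1" for x
    using card_rhombi_at_point[OF n, of x] unfolding d1_def l_def by (intro le_nat_floor)
  have "\<exists>U\<subseteq>int_grid n. sparse_hypergraph U {e \<in> rhombi n. e \<subseteq> U} \<and>
    card (int_grid n) * (p - 1 / D * real d1 * p ^ 4 - 16 * real d1 * (3 * real n) * p ^ 6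
      - 64 * real d1 * 3 * p ^ 5 - 16 * (real d1)\<^sup>2 * (3 * real n) * p ^ 9) \<le> card U - 1 / D * card {e \<in> rhombi n. e \<subseteq> U}"
    using sparse_subhypergraph[OF finite_int_grid rhombi_subset card_rhombi_elem deg1
        card_rhombi_at_pair card_rhombi_at_triple, where p = p and a = "1 / D"] p D
    by simp
  then obtain U where U: "U \<subseteq> int_grid n" "sparse_hypergraph U {e \<in> rhombi n. e \<subseteq> U}"
    "card (int_grid n) * (p - 1 / D * real d1 * p ^ 4 - 16 * real d1 * (3 * real n) * p ^ 6
      - 64 * real d1 * 3 * p ^ 5 - 16 * (real d1)\<^sup>2 * (3 * real n) * p ^ 9) \<le> card U - 1 / D * card {e \<in> rhombi n. e \<subseteq> U}"
    by blast
  have "1 / D * real d1 * p ^ 4 \<le> 1 / D * (1000 * (real n)\<^sup>2 * l) * p ^ 4"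
    using D p by (intro mult_right_mono mult_left_mono d1) simp_all
  also have "\<dots> = p / 4"
    using n l p by (simp add: D_def field_simps power_add[symmetric] eval_nat_numeral)
  finally have 1: "1 / D * real d1 * p ^ 4 \<le> p / 4" .
  have "16 * real d1 * (3 * real n) * p ^ 6 \<le> 16 * (1000 * (real n)\<^sup>2 * l) * (3 * real n) * p ^ 6"
    using p by (intro mult_right_mono mult_left_mono d1) simp_all
  also have "\<dots> = (48000 * real n ^ 3 * l * p ^ 5) * p" by (simp add: eval_nat_numeral)
  also have "\<dots> \<le> 1 / 12 * p" using bounds p by (intro mult_right_mono) auto
  finally have 2: "16 * real d1 * (3 * real n) * p ^ 6 \<le> p / 12" by simp
  have "64 * real d1 * 3 * p ^ 5 \<le> 64 * (1000 * (real n)\<^sup>2 * l) * 3 * p ^ 5"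
    using p by (intro mult_right_mono mult_left_mono d1) simp_all
  also have "\<dots> = (192000 * real n ^ 2 * l * p ^ 4) * p" by (simp add: eval_nat_numeral)
  also have "\<dots> \<le> 1 / 12 * p" using bounds p by (intro mult_right_mono) auto
  finally have 3: "64 * real d1 * 3 * p ^ 5 \<le> p / 12" by simp
  have "16 * (real d1)\<^sup>2 * (3 * real n) * p ^ 9 \<le> 16 * (1000 * (real n)\<^sup>2 * l)\<^sup>2 * (3 * real n) * p ^ 9"
    using p by (intro mult_right_mono mult_left_mono power_mono d1) simp_all
  also have "\<dots> = (48000000 * real n ^ 5 * l\<^sup>2 * p ^ 8) * p" by (simp add: eval_nat_numeral)
  also have "\<dots> \<le> 1 / 12 * p" using bounds p by (intro mult_right_mono) auto
  finally have 4: "16 * (real d1)\<^sup>2 * (3 * real n) * p ^ 9 \<le> p / 12" by simp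
  have "p / 2 \<le> p - 1 / D * real d1 * p ^ 4 - 16 * real d1 * (3 * real n) * p ^ 6
      - 64 * real d1 * 3 * p ^ 5 - 16 * (real d1)\<^sup>2 * (3 * real n) * p ^ 9"
    using 1 2 3 4 by simp
  then have "(real n)\<^sup>2 * (p / 2) \<le> (real n)\<^sup>2 * (p - 1 / D * real d1 * p ^ 4 - 16 * real d1 * (3 * real n) * p ^ 6
      - 64 * real d1 * 3 * p ^ 5 - 16 * (real d1)\<^sup>2 * (3 * real n) * p ^ 9)"
    by (rule mult_left_mono) simp
  also have "\<dots> \<le> card U - 1 / D * card {e \<in> rhombi n. e \<subseteq> U}"
    using U(3) unfolding card_int_grid of_nat_power .
  finally have "(real n)\<^sup>2 * p / 2 + card {e \<in> rhombi n. e \<subseteq> U} / D \<le> card U" by simp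
  moreover have "0 \<le> card {e \<in> rhombi n. e \<subseteq> U} / D" "0 \<le> (real n)\<^sup>2 * p / 2"
    using D p by simp_all
  ultimately have "(real n)\<^sup>2 * p / 2 \<le> card U" "card {e \<in> rhombi n. e \<subseteq> U} / D \<le> card U"
    by linarith+
  then have "card {e \<in> rhombi n. e \<subseteq> U} \<le> D * card U"
    using D by (simp add: pos_divide_le_eq mult.commute)
  then show ?thesis
    unfolding D_def using U(1,2) \<open>(real n)\<^sup>2 * p / 2 \<le> card U\<close> by blast
qed

lemma large_rhombus_free:
  "eventually (\<lambda>n. \<exists>S\<subseteq>grid n. rhombus_free S \<and> 1 / 40000 * real n powr (4 / 3) \<le> card S) at_top"
proof -
  \<comment> \<open>Up to logarithms the first three left sides are \<open>n\<close> to the powers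
    -1/6, -8/15 and -1/15. The third one requires the surplus exponent 1/30 to be below
    1/24.\<close>
  have ev: "eventually (\<lambda>n::nat. 48000 * real n ^ 3 * (1 + ln (real n)) * (real n powr (-19/30)) ^ 5 \<le> 1/12) at_top"
    "eventually (\<lambda>n::nat. 192000 * real n ^ 2 * (1 + ln (real n)) * (real n powr (-19/30)) ^ 4 \<le> 1/12) at_top"
    "eventually (\<lambda>n::nat. 48000000 * real n ^ 5 * (1 + ln (real n))\<^sup>2 * (real n powr (-19/30)) ^ 8 \<le> 1/12) at_top"
    "eventually (\<lambda>n::nat. 480 \<le> ln (real n)) at_top"
    by real_asymp+
  show ?thesis
    using ev eventually_ge_at_top[of 1]
  proof eventually_elim
    case (elim n)
    define x where "x = ln (real n)"
    have n: "0 < real n" and x: "480 \<le> x" using elim by (auto simp: x_def)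
    define p where "p = real n powr (- 19 / 30)"
    \<comment> \<open>\<open>q\<close> is the density asked of \<open>large_independent_set\<close>;
      it undoes the surplus 1/30 in the exponent of \<open>p\<close>. Accordingly \<open>X\<close>
      is chosen with \<open>exp (- 32 * X) = real n powr (- 1 / 30)\<close>.\<close>
    define q where "q = 1 / 20000 * real n powr (- 1 / 30)"
    define D where "D = 4000 * (real n)\<^sup>2 * (1 + x) * p ^ 3"
    define X where "X = x / 960"
    have p: "0 < p" using n by (simp add: p_def)
    obtain U where U: "U \<subseteq> int_grid n" "sparse_hypergraph U {e \<in> rhombi n. e \<subseteq> U}"
      "(real n)\<^sup>2 * p / 2 \<le> card U" "card {e \<in> rhombi n. e \<subseteq> U} \<le> D * card U"
      using sparse_rhombi[of n] elim unfolding p_def x_def D_def by auto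
    interpret sparse_hypergraph U "{e \<in> rhombi n. e \<subseteq> U}" by (rule U(2))
    have lnq: "ln q = - ln 20000 - x / 30"
      using n by (simp add: q_def x_def ln_mult ln_div ln_powr)
    have "ln (20000::real) \<le> ln (2 ^ 15)" by simp
    also have "\<dots> = real 15 * ln (2::real)" by (rule ln_realpow)
    also have "\<dots> \<le> 15" using ln_2_less_1 by simp
    finally have ln20000: "ln (20000::real) \<le> 15" .
    have "0 \<le> ln (20000::real)" by simp
    \<comment> \<open>This uses \<open>16 \<le> x / 30\<close>, the origin of the threshold
      480.\<close>
    then have lnq_bounds: "0 \<le> 1 - ln q" "1 - ln q \<le> x / 15"
      using lnq x ln20000 by linarith+
    have q: "0 < q" "q \<le> 1"
      using n elim powr_mono[of "- 1 / 30" 0 "real n"] by (auto simp: q_def)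
    \<comment> \<open>All powers of \<open>n\<close> cancel, so both sides of the density condition
      are of order \<open>x ^ 4\<close>; the logarithm from the rhombus count is absorbed at this
      point.\<close>
    have cancel: "(real n)\<^sup>2 * p ^ 3 * (real n powr (- 1 / 30)) ^ 3 = 1"
      using n by (simp add: p_def powr_powr flip: powr_numeral powr_add)
    have "D * (q * (1 - ln q)) ^ 3 =
        4000 / 20000 ^ 3 * ((real n)\<^sup>2 * p ^ 3 * (real n powr (- 1 / 30)) ^ 3) * (1 + x) * (1 - ln q) ^ 3"
      by (simp add: D_def q_def power_mult_distrib power_divide)
    also have "\<dots> \<le> 4000 / 20000 ^ 3 * ((real n)\<^sup>2 * p ^ 3 * (real n powr (- 1 / 30)) ^ 3) * (2 * x) * (x / 15) ^ 3"
      using x lnq_bounds p by (intro mult_mono power_mono mult_left_mono) auto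
    also have "\<dots> \<le> X ^ 4"
      unfolding cancel X_def using x by (simp add: power_divide eval_nat_numeral)
    finally have D_le: "D * (q * (1 - ln q)) ^ 3 \<le> X ^ 4" .
    have "exp (- 32 * X) = real n powr (- 1 / 30)"
      using n by (simp add: X_def x_def powr_def)
    then have q_le: "2 * q \<le> exp (- 32 * X)" using n by (simp add: q_def)
    have "U \<noteq> {}"
    proof
      assume "U = {}"
      then have "(real n)\<^sup>2 * p / 2 \<le> 0" using U(3) by simp
      then show False using n p by (simp add: mult_le_0_iff)
    qed
    moreover have "0 < X" using x by (simp add: X_def)
    ultimately obtain I where I: "I \<subseteq> U" "\<forall>e\<in>{e \<in> rhombi n. e \<subseteq> U}. \<not> e \<subseteq> I" "q * card U \<le> card I"
      using large_independent_set[OF _ U(4) q _ D_le q_le] by blast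
    have "\<forall>e\<in>rhombi n. \<not> e \<subseteq> I" using I(1,2) by blast
    then have "rhombus_free (embed ` I)"
      using I(1) U(1) by (intro rhombus_free_image_independent) auto
    moreover have "embed ` I \<subseteq> grid n"
      using I(1) U(1) by (auto simp flip: embed_int_grid)
    moreover have "1 / 40000 * real n powr (4 / 3) \<le> card (embed ` I)"
    proof -
      have "(real n)\<^sup>2 * p * real n powr (- 1 / 30) = real n powr (4 / 3)"
        using n by (simp add: p_def flip: powr_numeral powr_add)
      then have "1 / 40000 * real n powr (4 / 3) = q * ((real n)\<^sup>2 * p / 2)"
        by (simp add: q_def mult_ac)
      also have "\<dots> \<le> q * card U" using U(3) q by (intro mult_left_mono) auto
      also have "\<dots> \<le> card I" by (rule I(3))
      also have "card I = card (embed ` I)"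
        using inj_embed by (metis card_image inj_on_subset subset_UNIV)
      finally show ?thesis .
    qed
    ultimately show ?case by blast
  qed
qed

theorem theorem2:
  shows "\<exists>c::real. c > 0 \<and>
    (\<forall>n::nat. n \<ge> 1 \<longrightarrow>
      (\<exists>S. S \<subseteq> grid n \<and> rhombus_free S \<and> real (card S) \<ge> c * real n powr (4 / 3)))"
proof -
  obtain N where N: "\<And>n. N \<le> n \<Longrightarrow> \<exists>S\<subseteq>grid n. rhombus_free S \<and> 1 / 40000 * real n powr (4 / 3) \<le> card S"
    using large_rhombus_free unfolding eventually_at_top_linorder by blast
  define M where "M = real (max 1 N)"
  \<comment> \<open>For \<open>n\<close> below the threshold the second entry makes the required
    size at most 1, so that a single point suffices.\<close>
  define c where "c = min (1 / 40000) (M powr (- 4 / 3))"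
  have M: "0 < M" by (simp add: M_def)
  have "\<exists>S. S \<subseteq> grid n \<and> rhombus_free S \<and> real (card S) \<ge> c * real n powr (4 / 3)" if n: "n \<ge> 1" for n
  proof (cases "N \<le> n")
    case True
    then obtain S where S: "S \<subseteq> grid n" "rhombus_free S" "1 / 40000 * real n powr (4 / 3) \<le> card S"
      using N by blast
    have "c * real n powr (4 / 3) \<le> 1 / 40000 * real n powr (4 / 3)"
      by (intro mult_right_mono) (auto simp: c_def)
    then show ?thesis using S by (intro exI[of _ S]) linarith
  next
    case False
    have "c * real n powr (4 / 3) \<le> M powr (- 4 / 3) * M powr (4 / 3)"
      using False by (intro mult_mono powr_mono2) (auto simp: c_def M_def)
    also have "\<dots> = 1" using M by (simp flip: powr_add)
    finally have "c * real n powr (4 / 3) \<le> card {(1, 1) :: real \<times> real}" by simp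
    moreover have "{(1, 1)} \<subseteq> grid n" using n by (force simp: grid_def)
    moreover have "rhombus_free {(1, 1)}" by (auto simp: rhombus_free_def rhombus_def)
    ultimately show ?thesis by blast
  qed
  moreover have "0 < c" using M by (simp add: c_def)
  ultimately show ?thesis by blast
qed

end
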